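(* Let $\Omega\subset\mathbb H^n$ be an open, horizontally bounded and $H$-convex set, let $u:\Omega\to\mathbb R$ be an $H$-convex function and $v:\Omega\to\mathbb R$ a strictly $H$-convex function. Let $\Omega_0\subset\mathbb H^n$ be open with $\overline{\Omega_0}\subset\Omega$, and assume $u\le v$ in $\Omega_0$ and $u=v$ on $\partial\Omega_0$. Then $\partial_Hv(\Omega_0)\subset\partial_Hu(\Omega_0)$.
   Context: $\mathbb H^n=\mathbb C^n\times\mathbb R\cong\mathbb R^{2n+1}$ with real coordinates $(x,y,t)$, $z=x+iy$, group law $(z,t)\circ(z',t')=(z+z',t+t'+2\,\mathrm{Im}\langle z,z'\rangle)$, $\langle z,z'\rangle=\sum_j z_j\overline{z'_j}$. Dilations $\delta_\lambda(z,t)=(\lambda z,\lambda^2t)$. Horizontal plane at $\xi_0=(x_0,y_0,t_0)$: $H_{\xi_0}=\{(x,y,t):t=t_0+2(x\cdot y_0-x_0\cdot y)\}$. $\mathrm{Pr}_1(x,y,t)=(x,y)$. Gauge $N(z,t)=(|z|^4+t^2)^{1/4}$, $d_H(\xi,\zeta)=N(\zeta^{-1}\circ\xi)$, $\mathrm{diam}_H$ the $d_H$-diameter; $\Omega$ is horizontally bounded if $\sup\{\mathrm{diam}_H(\Omega\cap H_\xi):\xi\in\Omega\}<\infty$. A set $\tilde\Omega$ is $H$-convex if for all $\xi_1,\xi_2\in\tilde\Omega$ with $\xi_1\in H_{\xi_2}$ and $\lambda\in[0,1]$, $\xi_1\circ\delta_\lambda(\xi_1^{-1}\circ\xi_2)\in\tilde\Omega$;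 a function $u$ on $\tilde\Omega$ is $H$-convex if $u(\xi_1\circ\delta_\lambda(\xi_1^{-1}\circ\xi_2))\le(1-\lambda)u(\xi_1)+\lambda u(\xi_2)$ for all such $\xi_1,\xi_2,\lambda$, and strictly $H$-convex if the inequality is strict whenever $\xi_1\ne\xi_2$, $\xi_1\in H_{\xi_2}$ and $\lambda\in(0,1)$. For $w:\Omega\to\mathbb R$, $\partial_Hw(\xi)=\{p\in\mathbb R^{2n}:w(\zeta)\ge w(\xi)+p\cdot(\mathrm{Pr}_1(\zeta)-\mathrm{Pr}_1(\xi))\ \forall\zeta\in\Omega\cap H_\xi\}$, $\partial_Hw(E)=\bigcup_{\xi\in E}\partial_Hw(\xi)$. *)

theory Defs
  imports "HOL-Analysis.Analysis"
begin

text \<open>Heisenberg group H^n = C^n x R, represented as (x, y, t) with z = x + i y,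
  x, y :: real^'n (n = CARD('n)), t :: real.\<close>

type_synonym 'n heis = "(real^'n) \<times> (real^'n) \<times> real"

text \<open>Group law: (z,t)o(z',t') = (z+z', t+t'+2 Im<z,z'>), Im<z,z'> = y.x' - x.y'.\<close>
definition hmult :: "'n::finite heis \<Rightarrow> 'n heis \<Rightarrow> 'n heis" where
  "hmult p q = (case p of (x, y, t) \<Rightarrow> case q of (x', y', t') \<Rightarrow>
      (x + x', y + y', t + t' + 2 * (y \<bullet> x' - x \<bullet> y')))"

definition hinv :: "'n::finite heis \<Rightarrow> 'n heis" where
  "hinv p = (case p of (x, y, t) \<Rightarrow> (- x, - y, - t))"

definition hdil :: "real \<Rightarrow> 'n::finite heis \<Rightarrow> 'n heis" where
  "hdil l p = (case p of (x, y, t) \<Rightarrow> (l *\<^sub>R x, l *\<^sub>R y, l\<^sup>2 * t))"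

definition Hplane :: "'n::finite heis \<Rightarrow> 'n heis set" where
  "Hplane p0 = (case p0 of (x0, y0, t0) \<Rightarrow>
      {(x, y, t). t = t0 + 2 * (x \<bullet> y0 - x0 \<bullet> y)})"

definition Pr1 :: "'n::finite heis \<Rightarrow> (real^'n) \<times> (real^'n)" where
  "Pr1 p = (case p of (x, y, t) \<Rightarrow> (x, y))"

definition gauge :: "'n::finite heis \<Rightarrow> real" where
  "gauge p = (case p of (x, y, t) \<Rightarrow> ((norm x ^ 2 + norm y ^ 2) ^ 2 + t ^ 2) powr (1/4))"

definition dH :: "'n::finite heis \<Rightarrow> 'n heis \<Rightarrow> real" where
  "dH xi zeta = gauge (hmult (hinv zeta) xi)"

definition horiz_bounded :: "'n::finite heis set \<Rightarrow> bool" where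
  "horiz_bounded S \<longleftrightarrow> (\<exists>C. \<forall>xi\<in>S. \<forall>a\<in>S \<inter> Hplane xi. \<forall>b\<in>S \<inter> Hplane xi. dH a b \<le> C)"

definition H_convex_set :: "'n::finite heis set \<Rightarrow> bool" where
  "H_convex_set S \<longleftrightarrow> (\<forall>xi1\<in>S. \<forall>xi2\<in>S. xi1 \<in> Hplane xi2 \<longrightarrow>
      (\<forall>l\<in>{0..1}. hmult xi1 (hdil l (hmult (hinv xi1) xi2)) \<in> S))"

definition H_convex_fun :: "'n::finite heis set \<Rightarrow> ('n heis \<Rightarrow> real) \<Rightarrow> bool" where
  "H_convex_fun S u \<longleftrightarrow> (\<forall>xi1\<in>S. \<forall>xi2\<in>S. xi1 \<in> Hplane xi2 \<longrightarrow>
      (\<forall>l\<in>{0..1}. u (hmult xi1 (hdil l (hmult (hinv xi1) xi2))) \<le> (1 - l) * u xi1 + l * u xi2))"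

definition strictly_H_convex_fun :: "'n::finite heis set \<Rightarrow> ('n heis \<Rightarrow> real) \<Rightarrow> bool" where
  "strictly_H_convex_fun S u \<longleftrightarrow> H_convex_fun S u \<and>
     (\<forall>xi1\<in>S. \<forall>xi2\<in>S. xi1 \<noteq> xi2 \<longrightarrow> xi1 \<in> Hplane xi2 \<longrightarrow>
      (\<forall>l\<in>{0<..<1}. u (hmult xi1 (hdil l (hmult (hinv xi1) xi2))) < (1 - l) * u xi1 + l * u xi2))"

definition H_subdiff :: "'n::finite heis set \<Rightarrow> ('n heis \<Rightarrow> real) \<Rightarrow> 'n heis \<Rightarrow> ((real^'n) \<times> (real^'n)) set" where
  "H_subdiff S w xi = {p. \<forall>zeta\<in>S \<inter> Hplane xi. w zeta \<ge> w xi + p \<bullet> (Pr1 zeta - Pr1 xi)}"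

definition H_subdiff_set :: "'n::finite heis set \<Rightarrow> ('n heis \<Rightarrow> real) \<Rightarrow> 'n heis set \<Rightarrow> ((real^'n) \<times> (real^'n)) set" where
  "H_subdiff_set S w E = (\<Union>xi\<in>E. H_subdiff S w xi)"

end

theory Submission
  imports Defs
begin

text \<open>
  After subtracting the linear function \<open>p \<bullet> Pr1\<close> we may take \<open>p = 0\<close>: \<open>v\<close> has a strict minimum at
  \<open>\<xi>0\<close> on the horizontal plane through \<open>\<xi>0\<close>, and we need a point \<open>\<xi> \<in> \<Omega>0\<close> at which \<open>u\<close> is minimal on
  the horizontal plane through \<open>\<xi>\<close>. If there is none, then \<open>u\<close> has a horizontal descent direction at
  every point of the bounded plane section \<open>D\<close> of \<open>\<Omega>0\<close> through \<open>\<xi>0\<close>; on the boundary of \<open>D\<close> the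
  direction towards \<open>\<xi>0\<close> is one, because \<open>u \<xi>0 \<le> v \<xi>0 < v = u\<close> there. Descent directions form a convex
  cone and persist nearby, so cut-off functions glue them, together with the directions
  towards \<open>\<xi>0\<close> outside \<open>D\<close>, to a continuous vector field without zeros which points inwards on a large
  sphere. This contradicts Brouwer's theorem.

  The cone property needs \<open>u\<close> to be continuous. An H-convex function is continuous because it is
  locally bounded above, and that holds because a neighbourhood of a point can be generated from
  finitely many points by horizontal segments.
\<close>

section \<open>Horizontal planes and convexity along horizontal segments\<close>

lemma Hplane_iff [simp]: "(x, y, t) \<in> Hplane (x0, y0, t0) \<longleftrightarrow> t = t0 + 2 * (x \<bullet> y0 - x0 \<bullet> y)"
  by (simp add: Hplane_def)

lemma Hplane_refl: "a \<in> Hplane a"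
  by (cases a) (auto simp: inner_commute)

lemma Hplane_sym: "a \<in> Hplane b \<Longrightarrow> b \<in> Hplane a"
  by (cases a; cases b) (auto simp: inner_commute)

text \<open>For horizontally related points \<open>hmult (hinv a) b\<close> has vertical coordinate
  0, where dilations act linearly; the group segment is then a Euclidean one.\<close>

lemma H_segment:
  assumes "a \<in> Hplane b"
  shows "hmult a (hdil l (hmult (hinv a) b)) = (1 - l) *\<^sub>R a + l *\<^sub>R b"
proof -
  obtain x y t x' y' t' where ab: "a = (x, y, t)" "b = (x', y', t')" by (metis prod.exhaust)
  have t: "t = t' + 2 * (x \<bullet> y' - x' \<bullet> y)" using assms by (simp add: ab)
  show ?thesis
    unfolding ab t by (simp add: hmult_def hdil_def hinv_def algebra_simps inner_commute)
qed

text \<open>Convexity of set and function in one predicate, phrased with Euclidean segments: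
  Euclidean balls then qualify as domains, and affine changes of variable are easy.\<close>

definition H_convex_on :: "'n::finite heis set \<Rightarrow> ('n heis \<Rightarrow> real) \<Rightarrow> bool" where
  "H_convex_on S u \<longleftrightarrow> (\<forall>a\<in>S. \<forall>b\<in>S. a \<in> Hplane b \<longrightarrow>
      (\<forall>l\<in>{0..1}. (1 - l) *\<^sub>R a + l *\<^sub>R b \<in> S \<and>
         u ((1 - l) *\<^sub>R a + l *\<^sub>R b) \<le> (1 - l) * u a + l * u b))"

lemma H_convex_onI: "H_convex_set S \<Longrightarrow> H_convex_fun S u \<Longrightarrow> H_convex_on S u"
  unfolding H_convex_set_def H_convex_fun_def H_convex_on_def
  by (metis H_segment)

lemma H_convex_onD:
  assumes "H_convex_on S u" "a \<in> S" "b \<in> S" "a \<in> Hplane b" "0 \<le> l" "l \<le> 1"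
  shows "u ((1 - l) *\<^sub>R a + l *\<^sub>R b) \<le> (1 - l) * u a + l * u b"
    and "(1 - l) *\<^sub>R a + l *\<^sub>R b \<in> S"
  using assms unfolding H_convex_on_def by auto

lemma H_convex_on_le:
  assumes "H_convex_on S u" "a \<in> S" "b \<in> S" "a \<in> Hplane b" "0 \<le> l" "l \<le> 1"
    and "u a \<le> M" "u b \<le> M" "c = (1 - l) *\<^sub>R a + l *\<^sub>R b"
  shows "u c \<le> M"
proof -
  have "u c \<le> (1 - l) * u a + l * u b" using H_convex_onD[OF assms(1-6)] assms(9) by simp
  also have "\<dots> \<le> (1 - l) * M + l * M"
    using assms(5-8) by (intro add_mono mult_left_mono) auto
  finally show ?thesis by (simp add: algebra_simps)
qed

text \<open>Meant for left translations and dilations, which are affine and preserve horizontality;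
  they move local questions to balls around the origin.\<close>

lemma H_convex_on_affine_preimage:
  assumes u: "H_convex_on S u"
    and T: "\<And>a b l. T ((1 - l) *\<^sub>R a + l *\<^sub>R b) = (1 - l) *\<^sub>R T a + l *\<^sub>R T b"
    and H: "\<And>a b. a \<in> Hplane b \<Longrightarrow> T a \<in> Hplane (T b)"
    and B: "convex B" "\<And>a. a \<in> B \<Longrightarrow> T a \<in> S"
  shows "H_convex_on B (u \<circ> T)"
  unfolding H_convex_on_def
proof (intro ballI impI conjI)
  fix a b l assume ab: "a \<in> B" "b \<in> B" "a \<in> Hplane b" and l: "l \<in> {0..1::real}"
  show "(1 - l) *\<^sub>R a + l *\<^sub>R b \<in> B"
    using ab l B(1) by (auto simp: convex_alt)
  show "(u \<circ> T) ((1 - l) *\<^sub>R a + l *\<^sub>R b) \<le> (1 - l) * (u \<circ> T) a + l * (u \<circ> T) b"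
    using H_convex_onD(1)[OF u B(2)[OF ab(1)] B(2)[OF ab(2)] H[OF ab(3)]] l T by auto
qed

section \<open>Local upper bounds for H-convex functions\<close>

lemma norm_triple_le: "norm (x, y, t) \<le> norm x + norm y + norm (t::real)"
  using norm_Pair_le[of x "(y,t)"] norm_Pair_le[of y t] by linarith

text \<open>All points of the fan \<open>P\<close> are horizontally related to each other, so
  \<open>u \<circ> P\<close> is an ordinary convex function. It is continuous on the open ball,
  hence bounded on a smaller closed one.\<close>

lemma bounded_above_on_fan:
  fixes P :: "real^'n \<Rightarrow> 'n::finite heis"
  assumes u: "H_convex_on B u"
    and P: "\<And>y. norm y < K' \<Longrightarrow> P y \<in> B"
      "\<And>y y'. P y \<in> Hplane (P y')"
      "\<And>y y' l. P ((1 - l) *\<^sub>R y + l *\<^sub>R y') = (1 - l) *\<^sub>R P y + l *\<^sub>R P y'"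
    and K: "K < K'"
  shows "\<exists>M. \<forall>y. norm y \<le> K \<longrightarrow> u (P y) \<le> M"
proof -
  have "convex_on (ball 0 K') (u \<circ> P)"
  proof (rule convex_onI)
    fix t :: real and y y' :: "real^'n"
    assume t: "0 < t" "t < 1" and y: "y \<in> ball 0 K'" "y' \<in> ball 0 K'"
    have "u ((1 - t) *\<^sub>R P y + t *\<^sub>R P y') \<le> (1 - t) * u (P y) + t * u (P y')"
      using t y by (intro H_convex_onD(1)[OF u] P) auto
    then show "(u \<circ> P) ((1 - t) *\<^sub>R y + t *\<^sub>R y') \<le> (1 - t) * (u \<circ> P) y + t * (u \<circ> P) y'"
      by (simp add: P(3))
  qed auto
  then have "continuous_on (ball 0 K') (u \<circ> P)"
    by (intro convex_on_continuous) auto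
  then have "continuous_on (cball 0 K) (u \<circ> P)"
    by (rule continuous_on_subset) (use K in auto)
  then have "bounded ((u \<circ> P) ` cball 0 K)"
    by (intro compact_imp_bounded compact_continuous_image) auto
  then obtain M where "\<forall>v\<in>(u \<circ> P) ` cball 0 K. norm v \<le> M"
    unfolding bounded_iff by blast
  then show ?thesis by (intro exI[of _ M]) force
qed

text \<open>Joining the fans over \<open>- e\<close> and \<open>e\<close> gives, for \<open>h = 2\<close> and \<open>h = -2\<close>, two hypersurfaces that every
  fan \<open>(s e, \<cdot>, \<cdot>)\<close> with small \<open>s\<close> crosses on the two sides of \<open>(s e, y, t)\<close>. The numbers
  \<open>Y h\<close> and \<open>m h\<close> solve the two linear equations saying that the endpoints on the fans are
  horizontally related and that the segment between them meets the fan through \<open>(s e, y, t)\<close>.\<close>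

lemma bounded_above_over_axis:
  fixes e :: "real^'n::finite"
  assumes u: "H_convex_on (ball 0 100) u" and e: "norm e = 1"
  shows "\<exists>M. \<forall>s y t. \<bar>s\<bar> \<le> 1/4 \<longrightarrow> \<bar>t\<bar> \<le> 1/2 \<longrightarrow> norm y \<le> 2 \<longrightarrow> 0 \<le> e \<bullet> y \<longrightarrow> e \<bullet> y \<le> 3/2
           \<longrightarrow> u (s *\<^sub>R e, y, t) \<le> M"
proof -
  have ee: "e \<bullet> e = 1" using e by (simp add: dot_square_norm)
  \<comment> \<open>The term \<open>2 * \<sigma> * (e \<bullet> y)\<close> is what makes any two
    points with the same \<sigma> and \<open>c\<close> horizontally related.\<close>
  define P where "P = (\<lambda>\<sigma> c y. (\<sigma> *\<^sub>R e, y, c - 2 * \<sigma> * (e \<bullet> y)))"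
  have PB: "P \<sigma> c y \<in> ball 0 100" if "\<bar>\<sigma>\<bar> = 1" "\<bar>c\<bar> = 8" "norm y < 11" for \<sigma> c y
  proof -
    have "\<bar>e \<bullet> y\<bar> \<le> 11" using Cauchy_Schwarz_ineq2[of e y] e that by simp
    then have "\<bar>2 * \<sigma> * (e \<bullet> y)\<bar> \<le> 22" using that by (simp add: abs_mult)
    then have "\<bar>c - 2 * \<sigma> * (e \<bullet> y)\<bar> \<le> 30" using that by linarith
    then have "norm (P \<sigma> c y) < 100"
      using norm_triple_le[of "\<sigma> *\<^sub>R e" y "c - 2 * \<sigma> * (e \<bullet> y)"] that e by (simp add: P_def)
    then show ?thesis by simp
  qed
  have "\<exists>M. \<forall>y. norm y \<le> 10 \<longrightarrow> u (P \<sigma> c y) \<le> M" if "\<bar>\<sigma>\<bar> = 1" "\<bar>c\<bar> = 8" for \<sigma> c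
  proof (rule bounded_above_on_fan[OF u, where K' = 11])
    show "norm y < 11 \<Longrightarrow> P \<sigma> c y \<in> ball 0 100" for y by (rule PB[OF that])
    show "P \<sigma> c y \<in> Hplane (P \<sigma> c y')" for y y'
      by (simp add: P_def inner_commute algebra_simps)
    show "P \<sigma> c ((1 - l) *\<^sub>R y + l *\<^sub>R y') = (1 - l) *\<^sub>R P \<sigma> c y + l *\<^sub>R P \<sigma> c y'" for y y' l
      by (simp add: P_def algebra_simps)
  qed simp
  then obtain Mf where Mf: "\<And>\<sigma> c y. \<bar>\<sigma>\<bar> = 1 \<Longrightarrow> \<bar>c\<bar> = 8 \<Longrightarrow> norm y \<le> 10 \<Longrightarrow> u (P \<sigma> c y) \<le> Mf \<sigma> c"
    by metis
  define M where "M = Max {Mf 1 8, Mf 1 (-8), Mf (-1) 8, Mf (-1) (-8)}"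
  have M: "u (P \<sigma> c y) \<le> M" if "\<sigma> = 1 \<or> \<sigma> = -1" "c = 8 \<or> c = -8" "norm y \<le> 10" for \<sigma> c y
  proof -
    have "Mf \<sigma> c \<le> M" unfolding M_def by (rule Max_ge) (use that in auto)
    then show ?thesis using Mf[of \<sigma> c y] that by force
  qed
  have "u (s *\<^sub>R e, y, t) \<le> M"
    if s: "\<bar>s\<bar> \<le> 1/4" and t: "\<bar>t\<bar> \<le> 1/2" and y: "norm y \<le> 2" "0 \<le> e \<bullet> y" "e \<bullet> y \<le> 3/2" for s y t
  proof -
    define \<eta> where "\<eta> = e \<bullet> y"
    \<comment> \<open>With this \<tau> the given point is \<open>P s \<tau> y\<close>; the points
      \<open>C h\<close> below lie on the same fan and have \<open>e\<close>-component
      \<open>Y h\<close>.\<close>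
    define \<tau> where "\<tau> = t + 2 * s * \<eta>"
    define Y where "Y = (\<lambda>h. (h * (1 + s\<^sup>2) - s * \<tau> / 2) / (1 - s\<^sup>2))"
    define m where "m = (\<lambda>h. (\<tau> - 2 * s * Y h - 2 * h * s) / 2)"
    define C where "C = (\<lambda>h. (s *\<^sub>R e, y + (Y h - \<eta>) *\<^sub>R e, \<tau> - 2 * s * Y h))"
    have s2: "s\<^sup>2 \<le> 1/16" using power_mono[OF s, of 2] by (simp add: power2_eq_square)
    have "\<bar>s * \<eta>\<bar> \<le> 1/4 * (3/2)"
      unfolding abs_mult using s y by (intro mult_mono) (auto simp: \<eta>_def)
    then have tau: "\<bar>\<tau>\<bar> \<le> 5/4" using t unfolding \<tau>_def mult.assoc by linarith
    have stau: "\<bar>s * \<tau>\<bar> \<le> 1/4 * (5/4)"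
      unfolding abs_mult using s tau by (intro mult_mono) auto
    have Yeq: "Y h * (1 - s\<^sup>2) = h * (1 + s\<^sup>2) - s * \<tau> / 2" for h
      using s2 by (simp add: Y_def)
    have Yb: "\<bar>Y h\<bar> \<le> 5/2" if "\<bar>h\<bar> = 2" for h
    proof -
      have "\<bar>h * (1 + s\<^sup>2)\<bar> \<le> 2 * (17/16)" using that s2 by (simp add: abs_mult)
      then have "\<bar>Y h * (1 - s\<^sup>2)\<bar> \<le> 5/2 * (15/16)" unfolding Yeq using stau by linarith
      moreover have "\<bar>Y h\<bar> * (15/16) \<le> \<bar>Y h * (1 - s\<^sup>2)\<bar>"
        unfolding abs_mult using s2 by (intro mult_left_mono) auto
      ultimately show ?thesis by linarith
    qed
    have Y2: "Y 2 \<ge> 3/2"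
    proof (rule ccontr)
      assume "\<not> Y 2 \<ge> 3/2"
      then have "Y 2 * (1 - s\<^sup>2) \<le> 3/2 * (1 - s\<^sup>2)" using s2 by (intro mult_right_mono) auto
      then show False using Yeq[of 2] stau zero_le_power2[of s] by (simp add: algebra_simps abs_le_iff)
    qed
    have Y2': "Y (-2) \<le> 0"
    proof (rule ccontr)
      assume "\<not> Y (-2) \<le> 0"
      then have "Y (-2) * (1 - s\<^sup>2) \<ge> 0" using s2 by (intro mult_nonneg_nonneg) auto
      then show False using Yeq[of "-2"] stau zero_le_power2[of s] by (simp add: algebra_simps abs_le_iff)
    qed
    have mb: "\<bar>m h\<bar> \<le> 7/4" if "\<bar>h\<bar> = 2" for h
    proof -
      have "\<bar>s * Y h\<bar> \<le> 1/4 * (5/2)"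
        unfolding abs_mult by (rule mult_mono) (use s Yb[OF that] in auto)
      moreover have "\<bar>h * s\<bar> \<le> 2 * (1/4)"
        unfolding abs_mult by (rule mult_mono) (use s that in auto)
      moreover have "m h = \<tau> / 2 - s * Y h - h * s" by (simp add: m_def field_simps)
      moreover have "\<bar>\<tau> / 2 - a - b\<bar> \<le> 7/4" if "\<bar>a\<bar> \<le> 1/4 * (5/2)" "\<bar>b\<bar> \<le> 2 * (1/4)" for a b :: real
        using that tau by linarith
      ultimately show ?thesis by simp
    qed
    have C: "u (C h) \<le> M \<and> C h \<in> ball 0 100" if h: "h = 2 \<or> h = -2" for h
    proof -
      have ah: "\<bar>h\<bar> = 2" using h by auto
      \<comment> \<open>The endpoints over \<open>- e\<close> and \<open>e\<close> are horizontally
        related exactly if the \<open>e\<close>-components of \<open>ya\<close> and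
        \<open>yb\<close> add up to \<open>2 * h\<close>. Their difference, \<open>2 * m h\<close>,
        remains free to adjust the vertical coordinate.\<close>
      define ya where "ya = y + (h + m h - \<eta>) *\<^sub>R e"
      define yb where "yb = y + (h - m h - \<eta>) *\<^sub>R e"
      have "norm ya \<le> norm y + \<bar>h + m h - \<eta>\<bar>" "norm yb \<le> norm y + \<bar>h - m h - \<eta>\<bar>"
        unfolding ya_def yb_def
        using norm_triangle_ineq[of y "(h + m h - \<eta>) *\<^sub>R e"]
          norm_triangle_ineq[of y "(h - m h - \<eta>) *\<^sub>R e"] e by simp_all
      then have nb: "norm ya \<le> 10" "norm yb \<le> 10"
        using y mb[OF ah] ah \<eta>_def by linarith+
      have iy: "e \<bullet> ya = h + m h" "e \<bullet> yb = h - m h" "ya \<bullet> e = h + m h" "yb \<bullet> e = h - m h"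
        unfolding ya_def yb_def using ee by (auto simp: \<eta>_def inner_add inner_commute)
      have c: "-4 * h = 8 \<or> -4 * h = -8" "4 * h = 8 \<or> 4 * h = -8" using h by auto
      have rel: "P (-1) (-4*h) ya \<in> Hplane (P 1 (4*h) yb)"
        by (simp add: P_def iy)
      have comb: "(1 - k) *\<^sub>R (y + \<alpha> *\<^sub>R e) + k *\<^sub>R (y + \<beta> *\<^sub>R e) = y + ((1 - k) * \<alpha> + k * \<beta>) *\<^sub>R e"
        for k \<alpha> \<beta> by (simp add: algebra_simps)
      have "(1 - (1+s)/2) * (h + m h - \<eta>) + (1+s)/2 * (h - m h - \<eta>) = h - s * m h - \<eta>"
        by (simp add: field_simps)
      also have "h - s * m h = Y h"
        using Yeq[of h] by (simp add: m_def field_simps power2_eq_square)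
      finally have y_eq: "(1 - (1+s)/2) *\<^sub>R ya + ((1+s)/2) *\<^sub>R yb = y + (Y h - \<eta>) *\<^sub>R e"
        unfolding ya_def yb_def comb by simp
      have x_eq: "(1 - (1+s)/2) *\<^sub>R (- e) + ((1+s)/2) *\<^sub>R e = s *\<^sub>R e"
      proof -
        have "(1 - (1+s)/2) *\<^sub>R (- e) + ((1+s)/2) *\<^sub>R e = ((1+s)/2 - (1 - (1+s)/2)) *\<^sub>R e"
          by (simp only: scaleR_minus_right scaleR_diff_left) simp
        then show ?thesis by (simp add: field_simps)
      qed
      \<comment> \<open>The weight \<open>(1+s)/2\<close> is forced by the first coordinate, which
        runs from \<open>- e\<close> to \<open>e\<close> and has to equal
        \<open>s *\<^sub>R e\<close>.\<close>
      have eq: "C h = (1 - (1+s)/2) *\<^sub>R P (-1) (-4*h) ya + ((1+s)/2) *\<^sub>R P 1 (4*h) yb"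
        using x_eq y_eq by (simp add: P_def C_def iy) (simp add: m_def field_simps)
      have A: "P (-1) (-4*h) ya \<in> ball 0 100" "P 1 (4*h) yb \<in> ball 0 100"
        by (rule PB; use nb h in auto)+
      have l: "0 \<le> (1+s)/2" "(1+s)/2 \<le> 1" using s by auto
      have "u (C h) \<le> M"
        by (rule H_convex_on_le[OF u A rel l _ _ eq]) (use M c nb in auto)
      then show ?thesis using H_convex_onD(2)[OF u A rel l] eq by simp
    qed
    have rel: "C 2 \<in> Hplane (C (-2))"
      by (simp add: C_def inner_add inner_commute ee \<eta>_def[symmetric]) (simp add: algebra_simps ee)
    \<comment> \<open>Since \<open>Y (-2)\<close> \<le> 0 \<le> \<eta> \<le> 3/2 \<le>
      \<open>Y 2\<close>, the given point lies between the two crossings on its fan.\<close>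
    define l where "l = (Y 2 - \<eta>) / (Y 2 - Y (-2))"
    have l: "0 \<le> l" "l \<le> 1" using Y2 Y2' y by (auto simp: l_def \<eta>_def divide_simps)
    have leq: "(1 - l) * Y 2 + l * Y (-2) = \<eta>"
    proof -
      have "l * (Y 2 - Y (-2)) = Y 2 - \<eta>" using Y2 Y2' by (simp add: l_def)
      then show ?thesis by (simp add: algebra_simps)
    qed
    have "(1 - l) *\<^sub>R (y + (Y 2 - \<eta>) *\<^sub>R e) + l *\<^sub>R (y + (Y (-2) - \<eta>) *\<^sub>R e)
        = y + ((1 - l) * Y 2 + l * Y (-2) - \<eta>) *\<^sub>R e"
      by (simp add: algebra_simps)
    moreover have "(1 - l) * (\<tau> - 2 * s * Y 2) + l * (\<tau> - 2 * s * Y (-2))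
        = \<tau> - 2 * s * ((1 - l) * Y 2 + l * Y (-2))"
      by (simp add: algebra_simps)
    ultimately have eq: "(s *\<^sub>R e, y, t) = (1 - l) *\<^sub>R C 2 + l *\<^sub>R C (-2)"
      unfolding leq by (simp add: C_def \<tau>_def) (simp add: algebra_simps)
    show ?thesis
      by (rule H_convex_on_le[OF u _ _ rel l _ _ eq]) (use C in auto)
  qed
  then show ?thesis by blast
qed

text \<open>A point \<open>(x, y, t)\<close> is the midpoint of \<open>(s e, 2 y, \<cdot>)\<close> and \<open>(X, 0, 0)\<close>; the value of \<open>s\<close> is the one for
  which the endpoints are horizontally related.\<close>

lemma H_convex_on_eventually_bounded_above:
  fixes e :: "real^'n::finite"
  assumes u: "H_convex_on (ball 0 100) u" and e: "norm e = 1"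
  shows "\<exists>M. \<forall>\<^sub>F \<xi> in nhds (0, (1/2) *\<^sub>R e, 0). u \<xi> \<le> M"
proof -
  have ee: "e \<bullet> e = 1" using e by (simp add: dot_square_norm)
  obtain M1 where M1: "\<And>s y t. \<bar>s\<bar> \<le> 1/4 \<Longrightarrow> \<bar>t\<bar> \<le> 1/2 \<Longrightarrow> norm y \<le> 2 \<Longrightarrow> 0 \<le> e \<bullet> y
      \<Longrightarrow> e \<bullet> y \<le> 3/2 \<Longrightarrow> u (s *\<^sub>R e, y, t) \<le> M1"
    using bounded_above_over_axis[OF u e] by blast
  have "\<exists>M. \<forall>x. norm x \<le> 1 \<longrightarrow> u (x, 0, 0) \<le> M"
  proof (rule bounded_above_on_fan[OF u, where K' = 2])
    fix x :: "real^'n" assume "norm x < 2"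
    then have "norm (x, 0 :: real^'n, 0 :: real) < 100" using norm_triple_le[of x "0 :: real^'n" 0] by simp
    then show "(x, 0, 0) \<in> (ball 0 100 :: 'n heis set)" by simp
  qed auto
  then obtain M2 where M2: "\<And>x. norm x \<le> 1 \<Longrightarrow> u (x, 0, 0) \<le> M2" by blast
  define s where "s = (\<lambda>(x, y, t). (t + 4 * (x \<bullet> y)) / (2 * (e \<bullet> y)))"
  define X where "X = (\<lambda>(x, y, t). 2 *\<^sub>R x - s (x, y, t) *\<^sub>R e)"
  \<comment> \<open>At this centre the denominator \<open>2 * (e \<bullet> y)\<close> of
    \<open>s\<close> is 1, so \<open>s\<close> is continuous there; at the origin it would
    vanish.\<close>
  let ?c = "(0, (1/2) *\<^sub>R e, 0) :: 'n heis"
  have snd1: "((\<lambda>\<xi>. fst (snd \<xi>)) \<longlongrightarrow> (1/2) *\<^sub>R e) (nhds ?c)"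
    and fst1: "((\<lambda>\<xi>. fst \<xi>) \<longlongrightarrow> 0) (nhds ?c)"
    and thd1: "((\<lambda>\<xi>. snd (snd \<xi>)) \<longlongrightarrow> 0) (nhds ?c)"
    using tendsto_fst[OF tendsto_snd[OF filterlim_ident[of "nhds ?c"]]]
      tendsto_fst[OF filterlim_ident[of "nhds ?c"]]
      tendsto_snd[OF tendsto_snd[OF filterlim_ident[of "nhds ?c"]]] by simp_all
  have s_lim: "((\<lambda>\<xi>. (ft \<xi> + 4 * (fx \<xi> \<bullet> fy \<xi>)) / (2 * (e \<bullet> fy \<xi>))) \<longlongrightarrow> 0) F"
    if "(fx \<longlongrightarrow> 0) F" "(fy \<longlongrightarrow> (1/2) *\<^sub>R e) F" "(ft \<longlongrightarrow> 0) F"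
    for fx fy :: "'n heis \<Rightarrow> real^'n" and ft F
    using that by (auto intro!: tendsto_eq_intros simp: ee)
  have s: "(s \<longlongrightarrow> 0) (nhds ?c)"
    using s_lim[OF fst1 snd1 thd1] by (simp add: s_def case_prod_unfold)
  have "((\<lambda>\<xi>. 2 *\<^sub>R fst \<xi> - s \<xi> *\<^sub>R e) \<longlongrightarrow> 2 *\<^sub>R 0 - 0 *\<^sub>R e) (nhds ?c)"
    by (intro tendsto_diff tendsto_scaleR tendsto_const fst1 s)
  then have X: "(X \<longlongrightarrow> 0) (nhds ?c)" by (simp add: X_def case_prod_unfold)
  have t: "((\<lambda>\<xi>. - 4 * (X \<xi> \<bullet> fst (snd \<xi>))) \<longlongrightarrow> 0) (nhds ?c)"
    using tendsto_mult[OF tendsto_const[of "-4"] tendsto_inner[OF X snd1]] by simp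
  have y: "((\<lambda>\<xi>. 2 *\<^sub>R fst (snd \<xi>)) \<longlongrightarrow> e) (nhds ?c)"
    using tendsto_scaleR[OF tendsto_const[of 2] snd1] by simp
  have ey: "((\<lambda>\<xi>. e \<bullet> (2 *\<^sub>R fst (snd \<xi>))) \<longlongrightarrow> 1) (nhds ?c)"
    using tendsto_inner[OF tendsto_const[of e] y] ee by simp
  have "\<forall>\<^sub>F \<xi> in nhds ?c. \<bar>s \<xi>\<bar> < 1/4"
    using order_tendstoD(2)[OF tendsto_rabs[OF s], of "1/4"] by simp
  moreover have "\<forall>\<^sub>F \<xi> in nhds ?c. norm (X \<xi>) < 1"
    using order_tendstoD(2)[OF tendsto_norm[OF X], of 1] by simp
  moreover have "\<forall>\<^sub>F \<xi> in nhds ?c. \<bar>- 4 * (X \<xi> \<bullet> fst (snd \<xi>))\<bar> < 1/2"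
    using order_tendstoD(2)[OF tendsto_rabs[OF t], of "1/2"] by simp
  moreover have "\<forall>\<^sub>F \<xi> in nhds ?c. norm (2 *\<^sub>R fst (snd \<xi>)) < 2"
    using order_tendstoD(2)[OF tendsto_norm[OF y], of 2] e by simp
  moreover have "\<forall>\<^sub>F \<xi> in nhds ?c. e \<bullet> (2 *\<^sub>R fst (snd \<xi>)) < 3/2"
    using order_tendstoD(2)[OF ey, of "3/2"] by simp
  moreover have "\<forall>\<^sub>F \<xi> in nhds ?c. e \<bullet> (2 *\<^sub>R fst (snd \<xi>)) > 1/2"
    using order_tendstoD(1)[OF ey, of "1/2"] by simp
  ultimately have "\<forall>\<^sub>F \<xi> in nhds ?c. u \<xi> \<le> max M1 M2"
  proof eventually_elim
    case (elim \<xi>)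
    obtain x y t where \<xi>: "\<xi> = (x, y, t)" by (metis prod.exhaust)
    define \<sigma> where "\<sigma> = s \<xi>"
    define x' where "x' = X \<xi>"
    have x': "x' = 2 *\<^sub>R x - \<sigma> *\<^sub>R e" by (simp add: x'_def X_def \<sigma>_def \<xi>)
    have "e \<bullet> y > 0" using elim \<xi> by simp
    then have \<sigma>: "2 * \<sigma> * (e \<bullet> y) = t + 4 * (x \<bullet> y)" by (simp add: \<sigma>_def s_def \<xi>)
    \<comment> \<open>The vertical coordinate of \<open>?A\<close> is written so that its relation
      to \<open>?B\<close> is immediate; the choice of \<sigma> makes it equal to
      \<open>2 * t\<close>, as the midpoint requires.\<close>
    let ?A = "(\<sigma> *\<^sub>R e, 2 *\<^sub>R y, - 4 * (x' \<bullet> y))"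
    let ?B = "(x', 0, 0) :: 'n heis"
    have b: "\<bar>\<sigma>\<bar> < 1/4" "norm x' < 1" "\<bar>- 4 * (x' \<bullet> y)\<bar> < 1/2" "norm (2 *\<^sub>R y) < 2"
      "e \<bullet> (2 *\<^sub>R y) < 3/2" "e \<bullet> (2 *\<^sub>R y) > 1/2"
      using elim unfolding \<sigma>_def[symmetric] x'_def[symmetric] by (simp_all add: \<xi>)
    have A: "u ?A \<le> max M1 M2" using b by (intro max.coboundedI1 M1) auto
    have B: "u ?B \<le> max M1 M2" using b by (intro max.coboundedI2 M2) auto
    have "norm ?A < 100"
      using norm_triple_le[of "\<sigma> *\<^sub>R e" "2 *\<^sub>R y" "- 4 * (x' \<bullet> y)"] b e by simp
    moreover have "norm ?B < 100"
      using norm_triple_le[of x' "0 :: real^'n" 0] b by simp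
    ultimately have AB: "?A \<in> ball 0 100" "?B \<in> ball 0 100" by simp_all
    have rel: "?A \<in> Hplane ?B" by (simp add: inner_commute)
    have eq: "\<xi> = (1 - 1/2) *\<^sub>R ?A + (1/2) *\<^sub>R ?B"
      using \<sigma> by (simp add: \<xi> x' inner_diff_left) (simp add: vec_eq_iff algebra_simps)
    show ?case
      by (rule H_convex_on_le[OF u AB rel _ _ A B eq]) auto
  qed
  then show ?thesis by blast
qed

section \<open>Continuity at the origin from an upper bound\<close>

lemma Hplane_line:
  assumes "b \<in> Hplane a"
  shows "(1 - k) *\<^sub>R a + k *\<^sub>R b \<in> Hplane a"
proof -
  obtain x y t x' y' t' where ab: "a = (x, y, t)" "b = (x', y', t')" by (metis prod.exhaust)
  have t: "t' = t + 2 * (x' \<bullet> y - x \<bullet> y')" using assms by (simp add: ab)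
  show ?thesis unfolding ab t by (simp add: algebra_simps inner_commute)
qed

text \<open>The segment from \<open>a\<close> to \<open>b\<close> is prolonged beyond \<open>b\<close> by the factor \<open>1/\<theta>\<close> inside the ball.\<close>

lemma H_convex_on_Harnack_step:
  assumes u: "H_convex_on (ball 0 \<rho>) u" and M: "\<And>\<xi>. norm \<xi> < \<rho> \<Longrightarrow> u \<xi> \<le> M"
    and ab: "b \<in> Hplane a" "norm a < \<rho>/2" "norm (b - a) < \<theta> * (\<rho>/2)"
    and \<theta>: "0 < \<theta>" "\<theta> < 1"
  shows "(1 - \<theta>) * (M - u a) \<le> M - u b"
proof -
  define c where "c = (1 - 1/\<theta>) *\<^sub>R a + (1/\<theta>) *\<^sub>R b"
  have c: "c = a + (1/\<theta>) *\<^sub>R (b - a)" by (simp add: c_def algebra_simps)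
  have "norm ((1/\<theta>) *\<^sub>R (b - a)) = norm (b - a) / \<theta>" using \<theta> by simp
  also have "\<dots> < \<rho>/2" using ab(3) \<theta> by (simp add: field_simps)
  finally have nc: "norm c < \<rho>" unfolding c using ab(2) norm_triangle_ineq[of a]
    by (smt (verit) field_sum_of_halves)
  have na: "norm a < \<rho>" using ab(2) by (smt (verit) norm_ge_zero field_sum_of_halves)
  have "a \<in> Hplane c" unfolding c_def by (intro Hplane_sym[OF Hplane_line] ab)
  then have "u ((1 - \<theta>) *\<^sub>R a + \<theta> *\<^sub>R c) \<le> (1 - \<theta>) * u a + \<theta> * u c"
    using na nc \<theta> by (intro H_convex_onD(1)[OF u]) auto
  moreover have "(1 - \<theta>) *\<^sub>R a + \<theta> *\<^sub>R c = b" using \<theta> by (simp add: c algebra_simps)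
  moreover have "\<theta> * u c \<le> \<theta> * M" using M[OF nc] \<theta> by simp
  ultimately show ?thesis by (simp add: algebra_simps)
qed

text \<open>A point \<open>\<eta>\<close> near \<open>0\<close> is joined to \<open>0\<close> by three short horizontal segments through \<open>p\<close> and \<open>q \<eta>\<close>, where
  \<open>p\<close> does not depend on \<open>\<eta>\<close>.\<close>

lemma H_convex_on_isCont_0:
  fixes u :: "'n::finite heis \<Rightarrow> real"
  assumes u: "H_convex_on (ball 0 \<rho>) u" and M: "\<And>\<xi>. norm \<xi> < \<rho> \<Longrightarrow> u \<xi> \<le> M" and \<rho>: "\<rho> > 0"
  shows "isCont u 0"
proof -
  obtain e :: "real^'n" where e: "norm e = 1" using vector_choose_size[of 1] by auto
  have ee: "e \<bullet> e = 1" using e by (simp add: dot_square_norm)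
  let ?g = "\<lambda>\<xi>. M - u \<xi>"
  note step = H_convex_on_Harnack_step[OF u M]
  \<comment> \<open>Each of the three segments costs a factor \<open>1 - \<theta>\<close>.
    Horizontality is symmetric, so the comparison works in both directions.\<close>
  have key: "\<forall>\<^sub>F \<eta> in nhds 0. (1 - \<theta>)^3 * ?g 0 \<le> ?g \<eta> \<and> (1 - \<theta>)^3 * ?g \<eta> \<le> ?g 0"
    if \<theta>: "0 < \<theta>" "\<theta> < 1" for \<theta>
  proof -
    define \<delta> where "\<delta> = \<theta> * (\<rho>/4)"
    have \<delta>: "0 < \<delta>" "\<delta> < \<theta> * (\<rho>/2)" "\<delta> < \<rho>/2"
      using \<theta> \<rho> mult_strict_right_mono[of \<theta> 1 \<rho>] by (auto simp: \<delta>_def)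
    \<comment> \<open>\<beta> solves the equation saying that \<eta> and \<open>q \<eta>\<close> are
      horizontally related. Its denominator tends to \<open>- 2 * \<delta>\<close>, which is nonzero
      because the path first moves from 0 to \<open>p\<close>.\<close>
    define \<beta> where "\<beta> = (\<lambda>(x, y, t). (t + 2 * \<delta> * (e \<bullet> y)) / (2 * (x \<bullet> e - \<delta>)))"
    define p where "p = (\<delta> *\<^sub>R e, 0 :: real^'n, 0 :: real)"
    define q where "q = (\<lambda>\<eta>. (\<delta> *\<^sub>R e, \<beta> \<eta> *\<^sub>R e, - 2 * \<delta> * \<beta> \<eta>))"
    have lims: "((\<lambda>\<eta>. fst (snd \<eta>)) \<longlongrightarrow> 0) (nhds (0::'n heis))"
      "((\<lambda>\<eta>. fst \<eta>) \<longlongrightarrow> 0) (nhds (0::'n heis))"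
      "((\<lambda>\<eta>. snd (snd \<eta>)) \<longlongrightarrow> 0) (nhds (0::'n heis))"
      using tendsto_fst[OF tendsto_snd[OF filterlim_ident[of "nhds (0::'n heis)"]]]
        tendsto_fst[OF filterlim_ident[of "nhds (0::'n heis)"]]
        tendsto_snd[OF tendsto_snd[OF filterlim_ident[of "nhds (0::'n heis)"]]] by simp_all
    have \<beta>_lim: "((\<lambda>\<eta>. (ft \<eta> + 2 * \<delta> * (e \<bullet> fy \<eta>)) / (2 * (fx \<eta> \<bullet> e - \<delta>))) \<longlongrightarrow> 0) F"
      if "(fx \<longlongrightarrow> 0) F" "(fy \<longlongrightarrow> 0) F" "(ft \<longlongrightarrow> 0) F"
      for fx fy :: "'n heis \<Rightarrow> real^'n" and ft F
      using that \<delta> by (auto intro!: tendsto_eq_intros)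
    have \<beta>: "(\<beta> \<longlongrightarrow> 0) (nhds 0)"
      using \<beta>_lim[OF lims(2,1,3)] by (simp add: \<beta>_def case_prod_unfold)
    have "((\<lambda>\<eta>. (\<delta> *\<^sub>R e, \<beta> \<eta> *\<^sub>R e, - 2 * \<delta> * \<beta> \<eta>)) \<longlongrightarrow> (\<delta> *\<^sub>R e, 0 *\<^sub>R e, - 2 * \<delta> * 0)) (nhds 0)"
      by (intro tendsto_Pair tendsto_scaleR tendsto_mult tendsto_const \<beta>)
    then have q: "(q \<longlongrightarrow> p) (nhds 0)" by (simp add: q_def p_def)
    have np: "norm p = \<delta>" using \<delta> e by (simp add: p_def norm_Pair)
    have x: "((\<lambda>\<eta>::'n heis. fst \<eta> \<bullet> e) \<longlongrightarrow> 0) (nhds 0)"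
      using tendsto_inner[OF lims(2) tendsto_const[of e]] by simp
    have qp: "((\<lambda>\<eta>. norm (q \<eta> - p)) \<longlongrightarrow> 0) (nhds 0)"
      using tendsto_norm[OF tendsto_diff[OF q tendsto_const[of p]]] by simp
    have eq: "((\<lambda>\<eta>. norm (\<eta> - q \<eta>)) \<longlongrightarrow> \<delta>) (nhds 0)"
      using tendsto_norm[OF tendsto_diff[OF filterlim_ident[of "nhds 0"] q]] np by simp
    have "\<forall>\<^sub>F \<eta> in nhds 0. norm (q \<eta>) < \<rho>/2"
      using order_tendstoD(2)[OF tendsto_norm[OF q], of "\<rho>/2"] np \<delta> by simp
    moreover have "\<forall>\<^sub>F \<eta> in nhds 0. norm (q \<eta> - p) < \<theta> * (\<rho>/2)"
      using order_tendstoD(2)[OF qp, of "\<theta> * (\<rho>/2)"] \<theta> \<rho> by simp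
    moreover have "\<forall>\<^sub>F \<eta> in nhds 0. norm (\<eta> - q \<eta>) < \<theta> * (\<rho>/2)"
      using order_tendstoD(2)[OF eq, of "\<theta> * (\<rho>/2)"] \<delta> by simp
    moreover have "\<forall>\<^sub>F \<eta>::'n heis in nhds 0. norm \<eta> < \<rho>/2"
      using order_tendstoD(2)[OF tendsto_norm[OF filterlim_ident[of "nhds (0::'n heis)"]], of "\<rho>/2"] \<rho> by simp
    moreover have "\<forall>\<^sub>F \<eta>::'n heis in nhds 0. fst \<eta> \<bullet> e < \<delta>"
      using order_tendstoD(2)[OF x, of \<delta>] \<delta> by simp
    ultimately show ?thesis
    proof eventually_elim
      case (elim \<eta>)
      obtain x y t where \<eta>: "\<eta> = (x, y, t)" by (metis prod.exhaust)
      define b where "b = \<beta> \<eta>"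
      have b: "b * (2 * (x \<bullet> e - \<delta>)) = t + 2 * \<delta> * (e \<bullet> y)"
        using elim(5) by (simp add: b_def \<beta>_def \<eta>)
      have r1: "p \<in> Hplane 0" by (simp add: p_def zero_prod_def)
      have r2: "q \<eta> \<in> Hplane p" by (simp add: q_def p_def ee)
      have r3: "\<eta> \<in> Hplane (q \<eta>)"
        using b unfolding q_def b_def[symmetric] by (simp add: \<eta> algebra_simps)
      have g: "0 \<le> 1 - \<theta>" using \<theta> by simp
      have "(1 - \<theta>) * ?g 0 \<le> ?g p" "(1 - \<theta>) * ?g p \<le> ?g 0"
        using step[OF _ r1 _ _ \<theta>] step[OF _ Hplane_sym[OF r1] _ _ \<theta>] np \<delta> \<rho> by auto
      moreover have "(1 - \<theta>) * ?g p \<le> ?g (q \<eta>)" "(1 - \<theta>) * ?g (q \<eta>) \<le> ?g p"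
        using step[OF _ r2 _ _ \<theta>] step[OF _ Hplane_sym[OF r2] _ _ \<theta>] np \<delta> elim
        by (auto simp: norm_minus_commute)
      moreover have "(1 - \<theta>) * ?g (q \<eta>) \<le> ?g \<eta>" "(1 - \<theta>) * ?g \<eta> \<le> ?g (q \<eta>)"
        using step[OF _ r3 _ _ \<theta>] step[OF _ Hplane_sym[OF r3] _ _ \<theta>] elim
        by (auto simp: norm_minus_commute)
      ultimately have "(1 - \<theta>) * ((1 - \<theta>) * ((1 - \<theta>) * ?g 0)) \<le> ?g \<eta>"
        "(1 - \<theta>) * ((1 - \<theta>) * ((1 - \<theta>) * ?g \<eta>)) \<le> ?g 0"
        using g by (meson mult_left_mono order_trans)+
      then show ?case by (simp add: power3_eq_cube mult.assoc)
    qed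
  qed
  \<comment> \<open>The neighbourhood in \<open>key\<close> depends on \<theta>, so for each bound
    \<open>a\<close> a small \<theta> is fixed before \<eta> tends to 0.\<close>
  have "(?g \<longlongrightarrow> ?g 0) (nhds 0)"
  proof (rule order_tendstoI)
    fix a assume a: "a < ?g 0"
    have "((\<lambda>\<theta>. (1 - \<theta>)^3 * ?g 0) \<longlongrightarrow> ?g 0) (at_right (0::real))"
      by (auto intro!: tendsto_eq_intros)
    from order_tendstoD(1)[OF this a]
    have "\<forall>\<^sub>F \<theta> in at_right (0::real). a < (1 - \<theta>)^3 * ?g 0 \<and> \<theta> \<in> {0<..<1}"
      by (intro eventually_conj eventually_at_right_real) auto
    then obtain \<theta> where "a < (1 - \<theta>)^3 * ?g 0" "0 < \<theta>" "\<theta> < 1"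
      using eventually_happens'[OF trivial_limit_at_right_real] by fastforce
    then show "\<forall>\<^sub>F \<eta> in nhds 0. a < ?g \<eta>"
      using key[of \<theta>] by (auto elim: eventually_mono)
  next
    fix a assume a: "?g 0 < a"
    have "((\<lambda>\<theta>. (1 - \<theta>)^3 * a) \<longlongrightarrow> a) (at_right (0::real))"
      by (auto intro!: tendsto_eq_intros)
    from order_tendstoD(1)[OF this a]
    have "\<forall>\<^sub>F \<theta> in at_right (0::real). ?g 0 < (1 - \<theta>)^3 * a \<and> \<theta> \<in> {0<..<1}"
      by (intro eventually_conj eventually_at_right_real) auto
    then obtain \<theta> where \<theta>: "?g 0 < (1 - \<theta>)^3 * a" "0 < \<theta>" "\<theta> < 1"
      using eventually_happens'[OF trivial_limit_at_right_real] by fastforce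
    show "\<forall>\<^sub>F \<eta> in nhds 0. ?g \<eta> < a"
      using key[OF \<theta>(2,3)]
    proof eventually_elim
      case (elim \<eta>)
      then have "(1 - \<theta>)^3 * ?g \<eta> < (1 - \<theta>)^3 * a" using \<theta> by linarith
      then show ?case using \<theta> by simp
    qed
  qed
  then have "((\<lambda>\<eta>. M - ?g \<eta>) \<longlongrightarrow> M - ?g 0) (nhds 0)"
    by (rule tendsto_diff[OF tendsto_const])
  moreover have "M - (M - x) = x" for x by simp
  ultimately have "(u \<longlongrightarrow> u 0) (nhds 0)" by (simp only:)
  then show ?thesis by (simp add: isCont_def tendsto_nhds_iff)
qed

section \<open>Translations, dilations and continuity at every point\<close>

lemma hmult_hinv_cancel [simp]:
  "hmult a (hmult (hinv a) b) = b" "hmult (hinv a) (hmult a b) = b"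
  by (cases a; cases b; simp add: hmult_def hinv_def algebra_simps inner_commute)+

lemma hmult_0_right [simp]: "hmult a 0 = a"
  by (cases a) (simp add: hmult_def zero_prod_def)

lemma hmult_hinv_left [simp]: "hmult (hinv a) a = 0"
  by (cases a) (simp add: hmult_def hinv_def zero_prod_def inner_commute)

lemma hdil_0_right [simp]: "hdil r 0 = 0"
  by (simp add: hdil_def zero_prod_def)

lemma hdil_inverse [simp]: "r \<noteq> 0 \<Longrightarrow> hdil r (hdil (1/r) a) = a"
  by (cases a) (simp add: hdil_def power_divide)

lemma hmult_affine: "hmult a ((1 - l) *\<^sub>R b + l *\<^sub>R c) = (1 - l) *\<^sub>R hmult a b + l *\<^sub>R hmult a c"
  by (cases a; cases b; cases c) (simp add: hmult_def algebra_simps)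

lemma hdil_affine: "hdil r ((1 - l) *\<^sub>R b + l *\<^sub>R c) = (1 - l) *\<^sub>R hdil r b + l *\<^sub>R hdil r c"
  by (cases b; cases c) (simp add: hdil_def algebra_simps)

lemma Hplane_hmult: "b \<in> Hplane c \<Longrightarrow> hmult a b \<in> Hplane (hmult a c)"
  by (cases a; cases b; cases c) (simp add: hmult_def algebra_simps inner_commute)

lemma Hplane_hdil:
  assumes "b \<in> Hplane c"
  shows "hdil r b \<in> Hplane (hdil r c)"
proof -
  obtain x y t x' y' t' where bc: "b = (x, y, t)" "c = (x', y', t')" by (metis prod.exhaust)
  have t: "t = t' + 2 * (x \<bullet> y' - x' \<bullet> y)" using assms by (simp add: bc)
  show ?thesis unfolding bc t by (simp add: hdil_def algebra_simps power2_eq_square)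
qed

lemma continuous_on_hmult [continuous_intros]:
  "continuous_on S f \<Longrightarrow> continuous_on S g \<Longrightarrow> continuous_on S (\<lambda>x. hmult (f x) (g x))"
  unfolding hmult_def case_prod_beta by (intro continuous_intros)

lemma continuous_on_hdil [continuous_intros]:
  "continuous_on S f \<Longrightarrow> continuous_on S (\<lambda>x. hdil r (f x))"
  unfolding hdil_def case_prod_beta by (intro continuous_intros)

lemma norm_hdil_le:
  assumes "0 \<le> r" "r \<le> 1"
  shows "norm (hdil r a) \<le> 3 * r * norm a"
proof -
  obtain x y t where a: "a = (x, y, t)" by (metis prod.exhaust)
  have "norm x \<le> norm a" "norm (y, t) \<le> norm a" "norm y \<le> norm (y, t)" "\<bar>t\<bar> \<le> norm (y, t)"
    unfolding a using norm_fst_le[of x "(y,t)"] norm_snd_le[of "(y,t)" x]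
      norm_fst_le[of y t] norm_snd_le[of t y] by simp_all
  then have b: "norm x \<le> norm a" "norm y \<le> norm a" "\<bar>t\<bar> \<le> norm a" by linarith+
  have "norm (hdil r a) \<le> r * norm x + r * norm y + r^2 * \<bar>t\<bar>"
    using norm_triple_le[of "r *\<^sub>R x" "r *\<^sub>R y" "r\<^sup>2 * t"] assms
    by (simp add: a hdil_def abs_mult)
  also have "\<dots> \<le> r * norm a + r * norm a + r * norm a"
    using b assms by (intro add_mono mult_mono) (auto simp: power2_eq_square mult_left_le)
  finally show ?thesis by simp
qed

text \<open>A translated dilation \<open>T\<close> takes \<open>c\<close> to \<xi> and the ball of
  radius 100 into \<open>S\<close>, so the bound near \<open>c\<close> becomes a bound near \<xi>. A
  left translation then reduces continuity at \<xi> to continuity at 0.\<close>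

lemma H_convex_on_imp_continuous_on:
  fixes u :: "'n::finite heis \<Rightarrow> real"
  assumes S: "open S" and u: "H_convex_on S u"
  shows "continuous_on S u"
  unfolding continuous_on_eq_continuous_at[OF S]
proof
  fix \<xi> assume \<xi>: "\<xi> \<in> S"
  obtain e :: "real^'n" where e: "norm e = 1" using vector_choose_size[of 1] by auto
  define c where "c = (0 :: real^'n, (1/2) *\<^sub>R e, 0 :: real)"
  have cont: "isCont (hmult a) b" for a b :: "'n heis"
    using continuous_on_hmult[OF continuous_on_const continuous_on_id, of UNIV a]
    by (rule continuous_on_interior) simp
  have cont': "isCont (hdil r) b" for r and b :: "'n heis"
    using continuous_on_hdil[OF continuous_on_id, of UNIV r]
    by (rule continuous_on_interior) simp
  have "\<forall>\<^sub>F \<eta> in nhds 0. hmult \<xi> \<eta> \<in> S"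
    using topological_tendstoD[of "hmult \<xi>" "hmult \<xi> 0", OF _ S] cont[of 0 \<xi>] \<xi>
    by (simp add: isCont_def tendsto_nhds_iff)
  then obtain \<epsilon> where \<epsilon>: "\<epsilon> > 0" "\<And>\<eta>. norm \<eta> < \<epsilon> \<Longrightarrow> hmult \<xi> \<eta> \<in> S"
    unfolding eventually_nhds_metric by (auto simp: dist_norm)
  have "bounded (hmult (hinv c) ` cball 0 100)"
    by (intro compact_imp_bounded compact_continuous_image continuous_intros) auto
  then obtain K where K: "K > 0" "\<And>\<zeta>. norm \<zeta> \<le> 100 \<Longrightarrow> norm (hmult (hinv c) \<zeta>) \<le> K"
    unfolding bounded_pos by auto
  define r where "r = min 1 (\<epsilon> / (4 * K))"
  have r: "0 < r" "r \<le> 1" "r * (4 * K) \<le> \<epsilon>"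
    using \<epsilon> K by (auto simp: r_def min_def field_simps)
  define T where "T = (\<lambda>\<zeta>. hmult \<xi> (hdil r (hmult (hinv c) \<zeta>)))"
  define T' where "T' = (\<lambda>\<eta>. hmult c (hdil (1/r) (hmult (hinv \<xi>) \<eta>)))"
  have TS: "T \<zeta> \<in> S" if "norm \<zeta> < 100" for \<zeta>
    unfolding T_def
  proof (rule \<epsilon>(2))
    have "norm (hdil r (hmult (hinv c) \<zeta>)) \<le> 3 * r * K"
      using norm_hdil_le[of r] K(2)[of \<zeta>] r that
      by (smt (verit) mult_left_mono)
    also have "\<dots> < \<epsilon>" using r K(1) mult_pos_pos[OF r(1) K(1)] by linarith
    finally show "norm (hdil r (hmult (hinv c) \<zeta>)) < \<epsilon>" .
  qed
  have "H_convex_on (ball 0 100) (u \<circ> T)"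
    unfolding T_def
    by (rule H_convex_on_affine_preimage[OF u])
      (auto simp: hmult_affine hdil_affine TS[unfolded T_def] intro!: Hplane_hmult Hplane_hdil)
  from H_convex_on_eventually_bounded_above[OF this e]
  obtain M where M: "\<forall>\<^sub>F \<zeta> in nhds c. u (T \<zeta>) \<le> M" by (auto simp: c_def)
  have TL: "(\<lambda>\<eta>. hmult c (hdil (1/r) \<eta>)) \<midarrow>0\<rightarrow> c"
    using isCont_o2[OF cont'[of 0 "1/r"] cont[of _ c]] by (simp add: isCont_def)
  have "((\<lambda>\<eta>. hmult c (hdil (1/r) \<eta>)) \<longlongrightarrow> c) (nhds 0)"
    using TL by (simp add: tendsto_nhds_iff)
  from eventually_compose_filterlim[OF M this]
  have "\<forall>\<^sub>F \<eta> in nhds 0. u (hmult \<xi> \<eta>) \<le> M"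
    using r by (simp add: T_def)
  then obtain \<rho> where \<rho>: "\<rho> > 0" "\<And>\<eta>. norm \<eta> < \<rho> \<Longrightarrow> u (hmult \<xi> \<eta>) \<le> M"
    unfolding eventually_nhds_metric by (auto simp: dist_norm)
  have "H_convex_on (ball 0 (min \<epsilon> \<rho>)) (u \<circ> hmult \<xi>)"
    by (rule H_convex_on_affine_preimage[OF u]) (auto simp: hmult_affine \<epsilon> Hplane_hmult)
  then have "isCont (u \<circ> hmult \<xi>) 0"
    by (rule H_convex_on_isCont_0[where M = M]) (use \<epsilon> \<rho> in auto)
  then have "isCont (\<lambda>\<eta>. (u \<circ> hmult \<xi>) (hmult (hinv \<xi>) \<eta>)) \<xi>"
    using isCont_o2[OF cont[of \<xi> "hinv \<xi>"], of "u \<circ> hmult \<xi>"] by simp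
  then show "isCont u \<xi>" by simp
qed

section \<open>Horizontal displacements and descent directions\<close>

text \<open>Right multiplication by a horizontal element, that is, the time-one flow of a
  left-invariant horizontal field. It parametrises \<open>Hplane \<zeta>\<close> with inverse
  \<open>\<lambda>\<zeta>'. Pr1 \<zeta>' - Pr1 \<zeta>\<close>.\<close>

definition hexp :: "'n::finite heis \<Rightarrow> (real^'n) \<times> (real^'n) \<Rightarrow> 'n heis" where
  "hexp \<zeta> w = hmult \<zeta> (fst w, snd w, 0)"

lemma hexp_0 [simp]: "hexp \<zeta> 0 = \<zeta>"
  by (cases \<zeta>) (simp add: hexp_def hmult_def)

lemma hexp_in_Hplane: "hexp \<zeta> w \<in> Hplane \<zeta>"
  by (cases \<zeta>) (simp add: hexp_def hmult_def algebra_simps inner_commute)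

lemma hexp_Pr1_diff:
  assumes "\<zeta>' \<in> Hplane \<zeta>"
  shows "hexp \<zeta> (Pr1 \<zeta>' - Pr1 \<zeta>) = \<zeta>'"
proof -
  obtain x y t x' y' t' where z: "\<zeta> = (x, y, t)" "\<zeta>' = (x', y', t')" by (metis prod.exhaust)
  have t: "t' = t + 2 * (x' \<bullet> y - x \<bullet> y')" using assms by (simp add: z)
  show ?thesis unfolding z t by (simp add: hexp_def Pr1_def hmult_def algebra_simps inner_commute)
qed

lemma hexp_minus [simp]: "hexp (hexp \<zeta> w) (- w) = \<zeta>"
  by (cases \<zeta>) (simp add: hexp_def hmult_def algebra_simps inner_commute)

lemma hexp_scaleR: "hexp \<zeta> (l *\<^sub>R w) = (1 - l) *\<^sub>R \<zeta> + l *\<^sub>R hexp \<zeta> w"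
  by (cases \<zeta>) (simp add: hexp_def hmult_def algebra_simps)

lemma continuous_on_hexp [continuous_intros]:
  "continuous_on S f \<Longrightarrow> continuous_on S g \<Longrightarrow> continuous_on S (\<lambda>x. hexp (f x) (g x))"
  unfolding hexp_def by (intro continuous_intros)

text \<open>The step length is arbitrary rather than infinitesimal: a point of \<Omega> that is not
  minimal on its plane section thus has a descent direction at once, and convexity supplies the
  decrease for short steps.\<close>

definition H_descent :: "'n::finite heis set \<Rightarrow> ('n heis \<Rightarrow> real) \<Rightarrow> 'n heis
    \<Rightarrow> (real^'n) \<times> (real^'n) \<Rightarrow> bool" where
  "H_descent S u \<zeta> w \<longleftrightarrow> (\<exists>h>0. hexp \<zeta> (h *\<^sub>R w) \<in> S \<and> u (hexp \<zeta> (h *\<^sub>R w)) < u \<zeta>)"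

lemma not_H_descent_0 [simp]: "\<not> H_descent S u \<zeta> 0"
  by (simp add: H_descent_def)

lemma H_descent_scaleR:
  assumes "H_descent S u \<zeta> w" "k > 0"
  shows "H_descent S u \<zeta> (k *\<^sub>R w)"
proof -
  obtain h where "h > 0" "hexp \<zeta> (h *\<^sub>R w) \<in> S \<and> u (hexp \<zeta> (h *\<^sub>R w)) < u \<zeta>"
    using assms(1) by (auto simp: H_descent_def)
  then show ?thesis
    unfolding H_descent_def using assms(2) by (intro exI[of _ "h / k"]) simp
qed

text \<open>By continuity at least half of the gap \<open>g\<close> at step length \<open>h\<close>
  survives near \<zeta>; convexity along the segment spreads it linearly, with rate
  \<open>g / (2 * h)\<close>. The rate is uniform in the base point, as the zigzag argument
  requires.\<close>

lemma H_descent_eventually_rate: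
  assumes S: "open S" and u: "H_convex_on S u" and \<zeta>: "\<zeta> \<in> S" and d: "H_descent S u \<zeta> w"
  shows "\<exists>c>0. \<exists>h>0. \<forall>\<^sub>F \<zeta>' in nhds \<zeta>. \<zeta>' \<in> S \<and>
           (\<forall>k. 0 \<le> k \<longrightarrow> k \<le> h \<longrightarrow> hexp \<zeta>' (k *\<^sub>R w) \<in> S \<and> u (hexp \<zeta>' (k *\<^sub>R w)) \<le> u \<zeta>' - c * k)"
proof -
  obtain h where h: "h > 0" "hexp \<zeta> (h *\<^sub>R w) \<in> S" "u (hexp \<zeta> (h *\<^sub>R w)) < u \<zeta>"
    using d by (auto simp: H_descent_def)
  have cu: "isCont u \<xi>" if "\<xi> \<in> S" for \<xi>
    using H_convex_on_imp_continuous_on[OF S u] continuous_on_eq_continuous_at[OF S] that by blast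
  have ce: "isCont (\<lambda>\<zeta>. hexp \<zeta> (h *\<^sub>R w)) \<zeta>"
    using continuous_on_hexp[OF continuous_on_id continuous_on_const, of UNIV "h *\<^sub>R w"]
    by (rule continuous_on_interior) simp
  define g where "g = u \<zeta> - u (hexp \<zeta> (h *\<^sub>R w))"
  have g: "g > 0" using h by (simp add: g_def)
  have "isCont (\<lambda>\<zeta>'. u \<zeta>' - u (hexp \<zeta>' (h *\<^sub>R w))) \<zeta>"
    using isCont_o2[OF ce cu[OF h(2)]] cu[OF \<zeta>] by (intro continuous_diff)
  then have "((\<lambda>\<zeta>'. u \<zeta>' - u (hexp \<zeta>' (h *\<^sub>R w))) \<longlongrightarrow> g) (nhds \<zeta>)"
    by (simp add: isCont_def tendsto_nhds_iff g_def)
  from order_tendstoD(1)[OF this, of "g/2"] g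
  have "\<forall>\<^sub>F \<zeta>' in nhds \<zeta>. g/2 < u \<zeta>' - u (hexp \<zeta>' (h *\<^sub>R w))" by simp
  moreover have "\<forall>\<^sub>F \<zeta>' in nhds \<zeta>. \<zeta>' \<in> S" using S \<zeta> by (rule eventually_nhds_in_open)
  moreover have "\<forall>\<^sub>F \<zeta>' in nhds \<zeta>. hexp \<zeta>' (h *\<^sub>R w) \<in> S"
    using ce topological_tendstoD[of "\<lambda>\<zeta>. hexp \<zeta> (h *\<^sub>R w)" "hexp \<zeta> (h *\<^sub>R w)", OF _ S] h(2)
    by (simp add: isCont_def tendsto_nhds_iff)
  ultimately have "\<forall>\<^sub>F \<zeta>' in nhds \<zeta>. \<zeta>' \<in> S \<and> (\<forall>k. 0 \<le> k \<longrightarrow> k \<le> h \<longrightarrow>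
      hexp \<zeta>' (k *\<^sub>R w) \<in> S \<and> u (hexp \<zeta>' (k *\<^sub>R w)) \<le> u \<zeta>' - g / (2 * h) * k)"
  proof eventually_elim
    case (elim \<zeta>')
    show ?case
    proof (intro conjI allI impI)
      fix k assume k: "0 \<le> k" "k \<le> h"
      define l where "l = k / h"
      have l: "0 \<le> l" "l \<le> 1" using k h(1) by (auto simp: l_def)
      have eq: "hexp \<zeta>' (k *\<^sub>R w) = (1 - l) *\<^sub>R \<zeta>' + l *\<^sub>R hexp \<zeta>' (h *\<^sub>R w)"
        using hexp_scaleR[of \<zeta>' l "h *\<^sub>R w"] h(1) by (simp add: l_def)
      note D = H_convex_onD[OF u elim(2,3) Hplane_sym[OF hexp_in_Hplane] l]
      show "hexp \<zeta>' (k *\<^sub>R w) \<in> S" using D(2) eq by simp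
      have "u (hexp \<zeta>' (k *\<^sub>R w)) \<le> u \<zeta>' - l * (u \<zeta>' - u (hexp \<zeta>' (h *\<^sub>R w)))"
        using D(1) unfolding eq[symmetric] by (simp add: algebra_simps)
      also have "\<dots> \<le> u \<zeta>' - l * (g/2)"
        using elim(1) l by (intro diff_left_mono mult_left_mono) auto
      also have "l * (g/2) = g / (2 * h) * k" by (simp add: l_def mult.commute)
      finally show "u (hexp \<zeta>' (k *\<^sub>R w)) \<le> u \<zeta>' - g / (2 * h) * k" .
    qed (use elim in auto)
  qed
  moreover have "g / (2 * h) > 0" using g h(1) by simp
  ultimately show ?thesis using h(1) by blast
qed

lemma H_descent_eventually:
  assumes "open S" "H_convex_on S u" "\<zeta> \<in> S" "H_descent S u \<zeta> w"
  shows "\<forall>\<^sub>F \<zeta>' in nhds \<zeta>. H_descent S u \<zeta>' w"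
proof -
  obtain c h where ch: "c > 0" "h > 0" and ev: "\<forall>\<^sub>F \<zeta>' in nhds \<zeta>. \<zeta>' \<in> S \<and>
      (\<forall>k. 0 \<le> k \<longrightarrow> k \<le> h \<longrightarrow> hexp \<zeta>' (k *\<^sub>R w) \<in> S \<and> u (hexp \<zeta>' (k *\<^sub>R w)) \<le> u \<zeta>' - c * k)"
    using H_descent_eventually_rate[OF assms] by blast
  show ?thesis
    using ev
  proof eventually_elim
    case (elim \<zeta>')
    then have "hexp \<zeta>' (h *\<^sub>R w) \<in> S" "u (hexp \<zeta>' (h *\<^sub>R w)) \<le> u \<zeta>' - c * h" using ch by auto
    moreover have "c * h > 0" using ch by simp
    ultimately have "u (hexp \<zeta>' (h *\<^sub>R w)) < u \<zeta>'" by linarith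
    with \<open>hexp \<zeta>' (h *\<^sub>R w) \<in> S\<close> show ?case using ch unfolding H_descent_def by (intro exI[of _ h]) auto
  qed
qed

text \<open>Lines in a horizontal plane that miss its centre are not horizontal, so convexity does not apply
  directly. Instead \<open>exp (r (w\<^sub>1 + w\<^sub>2))\<close> is the limit of \<open>(exp (r w\<^sub>1 / N) exp (r w\<^sub>2 / N))\<^sup>N\<close>, and along each
  of these horizontal zigzags \<open>u\<close> decreases at a rate that does not depend on \<open>N\<close>.\<close>

lemma H_descent_add:
  assumes S: "open S" and u: "H_convex_on S u" and \<zeta>: "\<zeta> \<in> S"
    and d: "H_descent S u \<zeta> w1" "H_descent S u \<zeta> w2"
  shows "H_descent S u \<zeta> (w1 + w2)"
proof -
  have cu: "isCont u \<xi>" if "\<xi> \<in> S" for \<xi>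
    using H_convex_on_imp_continuous_on[OF S u] continuous_on_eq_continuous_at[OF S] that by blast
  obtain c1 h1 where c1: "c1 > 0" "h1 > 0" and ev1: "\<forall>\<^sub>F \<zeta>' in nhds \<zeta>. \<zeta>' \<in> S \<and>
      (\<forall>k. 0 \<le> k \<longrightarrow> k \<le> h1 \<longrightarrow> hexp \<zeta>' (k *\<^sub>R w1) \<in> S \<and> u (hexp \<zeta>' (k *\<^sub>R w1)) \<le> u \<zeta>' - c1 * k)"
    using H_descent_eventually_rate[OF S u \<zeta> d(1)] by blast
  obtain c2 h2 where c2: "c2 > 0" "h2 > 0" and ev2: "\<forall>\<^sub>F \<zeta>' in nhds \<zeta>. \<zeta>' \<in> S \<and>
      (\<forall>k. 0 \<le> k \<longrightarrow> k \<le> h2 \<longrightarrow> hexp \<zeta>' (k *\<^sub>R w2) \<in> S \<and> u (hexp \<zeta>' (k *\<^sub>R w2)) \<le> u \<zeta>' - c2 * k)"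
    using H_descent_eventually_rate[OF S u \<zeta> d(2)] by blast
  obtain a1 b1 a2 b2 where w: "w1 = (a1, b1)" "w2 = (a2, b2)" by (metis prod.exhaust)
  \<comment> \<open>A zigzag \<open>h *\<^sub>R w1\<close>, \<open>h *\<^sub>R w2\<close> differs
    from the step \<open>h *\<^sub>R (w1 + w2)\<close> by the vertical amount
    \<open>h\<^sup>2 * \<omega>\<close>. After \<open>k\<close> zigzags the path is at
    \<open>Q (k * h) (k * h\<^sup>2 * \<omega>)\<close>.\<close>
  define \<omega> where "\<omega> = 2 * (b1 \<bullet> a2 - a1 \<bullet> b2)"
  define Q where "Q = (\<lambda>s \<tau>. hmult \<zeta> (s *\<^sub>R (a1 + a2), s *\<^sub>R (b1 + b2), \<tau>))"
  \<comment> \<open>The third parameter adds a half-finished zigzag, so all corners of all paths are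
    values of one continuous map near 0 and a single \<delta> serves every \<open>N\<close>.\<close>
  define F where "F = (\<lambda>p. hexp (Q (fst p) (fst (snd p))) (snd (snd p) *\<^sub>R w1))"
  have "continuous_on UNIV F" unfolding F_def Q_def by (intro continuous_intros)
  then have "isCont F 0" by (rule continuous_on_interior) simp
  moreover have F0: "F 0 = \<zeta>" by (simp add: F_def Q_def flip: zero_prod_def)
  ultimately have "(F \<longlongrightarrow> \<zeta>) (nhds 0)" by (simp add: isCont_def tendsto_nhds_iff)
  from eventually_compose_filterlim[OF eventually_conj[OF ev1 ev2] this]
  obtain \<delta> where \<delta>: "\<delta> > 0" and near: "\<And>p. norm p < \<delta> \<Longrightarrow> F p \<in> S \<and>
      (\<forall>k. 0 \<le> k \<longrightarrow> k \<le> h1 \<longrightarrow> hexp (F p) (k *\<^sub>R w1) \<in> S \<and> u (hexp (F p) (k *\<^sub>R w1)) \<le> u (F p) - c1 * k) \<and>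
      (\<forall>k. 0 \<le> k \<longrightarrow> k \<le> h2 \<longrightarrow> hexp (F p) (k *\<^sub>R w2) \<in> S \<and> u (hexp (F p) (k *\<^sub>R w2)) \<le> u (F p) - c2 * k)"
    unfolding eventually_nhds_metric by (auto simp: dist_norm)
  define r where "r = min (min h1 h2) (min 1 (\<delta> / (4 * (1 + \<bar>\<omega>\<bar>))))"
  have r: "r > 0" "r \<le> h1" "r \<le> h2" "r \<le> 1" using c1 c2 \<delta> by (auto simp: r_def)
  have "r \<le> \<delta> / (4 * (1 + \<bar>\<omega>\<bar>))" by (simp add: r_def)
  then have "r * (4 * (1 + \<bar>\<omega>\<bar>)) \<le> \<delta>" by (subst (asm) pos_le_divide_eq) auto
  then have r\<delta>: "4 * r + 4 * (r * \<bar>\<omega>\<bar>) \<le> \<delta>" by (simp add: algebra_simps)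
  have small: "norm (s, \<tau>, h) < \<delta>" if "\<bar>s\<bar> \<le> r" "\<bar>\<tau>\<bar> \<le> r * \<bar>\<omega>\<bar>" "\<bar>h\<bar> \<le> r" for s \<tau> h :: real
  proof -
    have "norm (s, \<tau>, h) \<le> \<bar>s\<bar> + \<bar>\<tau>\<bar> + \<bar>h\<bar>" using norm_triple_le[of s \<tau> h] by simp
    moreover have "0 \<le> r * \<bar>\<omega>\<bar>" using r by simp
    ultimately show ?thesis using that r\<delta> r(1) by linarith
  qed
  define L where "L = hexp \<zeta> (r *\<^sub>R (w1 + w2))"
  have L: "L = F (r, 0, 0)" by (simp add: L_def F_def Q_def hexp_def w) (simp add: hmult_def split: prod.split)
  have LS: "L \<in> S" unfolding L using near[OF small[of r 0 0]] r by simp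
  define c where "c = c1 + c2"
  \<comment> \<open>With \<open>h = r / N\<close> the vertical error after \<open>N\<close> zigzags
    is \<open>N * h\<^sup>2 * \<omega> = r\<^sup>2 * \<omega> / N\<close>, which vanishes in the
    limit, while the decrease \<open>c * r\<close> stays.\<close>
  have zigzag: "u (Q r (r\<^sup>2 * \<omega> / real N)) \<le> u \<zeta> - c * r" if N: "N > 0" for N :: nat
  proof -
    define h where "h = r / real N"
    have h: "0 < h" "h \<le> r" using r N by (auto simp: h_def field_simps)
    have "u (Q (real k * h) (real k * h\<^sup>2 * \<omega>)) \<le> u \<zeta> - c * (real k * h)" if "k \<le> N" for k
      using that
    proof (induction k)
      case 0
      show ?case by (simp add: Q_def flip: zero_prod_def)
    next
      case (Suc k)
      let ?q = "Q (real k * h) (real k * h\<^sup>2 * \<omega>)"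
      have kh: "real k * h \<le> r" using Suc.prems r N by (simp add: h_def field_simps)
      have hr: "real k * h\<^sup>2 \<le> r"
      proof -
        have "real k * h\<^sup>2 = (real k * h) * h" by (simp add: power2_eq_square)
        also have "\<dots> \<le> r * 1" using kh h r by (intro mult_mono) auto
        finally show ?thesis by simp
      qed
      have tau: "\<bar>real k * h\<^sup>2 * \<omega>\<bar> \<le> r * \<bar>\<omega>\<bar>"
        unfolding abs_mult[of _ \<omega>] using hr by (intro mult_right_mono) auto
      have kh0: "\<bar>real k * h\<bar> \<le> r" using kh h by simp
      have q0: "?q = F (real k * h, real k * h\<^sup>2 * \<omega>, 0)" by (simp add: F_def)
      have q1: "hexp ?q (h *\<^sub>R w1) = F (real k * h, real k * h\<^sup>2 * \<omega>, h)" by (simp add: F_def)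
      have "u (hexp ?q (h *\<^sub>R w1)) \<le> u ?q - c1 * h"
        unfolding q0 using near[OF small[OF kh0 tau, of 0]] h r by simp
      moreover have "u (hexp (hexp ?q (h *\<^sub>R w1)) (h *\<^sub>R w2)) \<le> u (hexp ?q (h *\<^sub>R w1)) - c2 * h"
        unfolding q1 using near[OF small[OF kh0 tau, of h]] h r by simp
      moreover have "hexp (hexp ?q (h *\<^sub>R w1)) (h *\<^sub>R w2) = Q (real (Suc k) * h) (real (Suc k) * h\<^sup>2 * \<omega>)"
        by (cases \<zeta>)
          (simp add: Q_def hexp_def hmult_def w \<omega>_def algebra_simps inner_commute power2_eq_square)
      moreover have "u ?q \<le> u \<zeta> - c * (real k * h)" using Suc by simp
      ultimately show ?case by (simp add: c_def algebra_simps)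
    qed
    from this[of N] show ?thesis using N by (simp add: h_def power2_eq_square field_simps)
  qed
  have "(\<lambda>N. r\<^sup>2 * \<omega> / real N) \<longlonglongrightarrow> 0" by (rule lim_const_over_n)
  then have lim: "(\<lambda>N. F (r, r\<^sup>2 * \<omega> / real N, 0)) \<longlonglongrightarrow> F (r, 0, 0)"
    using \<open>continuous_on UNIV F\<close>
    by (intro continuous_on_tendsto_compose[of UNIV F] tendsto_Pair tendsto_const) auto
  have "(\<lambda>N. u (F (r, r\<^sup>2 * \<omega> / real N, 0))) \<longlonglongrightarrow> u L"
    using isCont_tendsto_compose[OF cu[OF LS]] lim L by simp
  moreover have "\<forall>\<^sub>F N in sequentially. u (F (r, r\<^sup>2 * \<omega> / real N, 0)) \<le> u \<zeta> - c * r"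
    using eventually_gt_at_top[of 0] by eventually_elim (use zigzag in \<open>simp add: F_def\<close>)
  ultimately have "u L \<le> u \<zeta> - c * r"
    by (rule tendsto_upperbound) simp
  moreover have "c * r > 0" using c1 c2 r by (simp add: c_def)
  ultimately show ?thesis
    unfolding H_descent_def using r(1) LS by (intro exI[of _ r]) (simp add: L_def)
qed

section \<open>Horizontal minima and the comparison of subdifferentials\<close>

lemma Pr1_affine: "Pr1 ((1 - l) *\<^sub>R a + l *\<^sub>R b) = (1 - l) *\<^sub>R Pr1 a + l *\<^sub>R Pr1 b"
  by (cases a; cases b) (simp add: Pr1_def)

text \<open>The displacement is purely horizontal, so the gauge reduces to the Euclidean norm;
  horizontal boundedness thereby bounds the plane section of \<open>\<Omega>0\<close>.\<close>

lemma dH_hexp: "dH (hexp \<zeta> w) \<zeta> = norm w"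
proof -
  obtain a b where w: "w = (a, b)" by (metis prod.exhaust)
  have n: "(norm a)\<^sup>2 + (norm b)\<^sup>2 = (norm w)\<^sup>2" by (simp add: w norm_Pair)
  have "dH (hexp \<zeta> w) \<zeta> = (((norm w)\<^sup>2)\<^sup>2) powr (1/4)"
    unfolding dH_def hexp_def by (simp add: gauge_def w[symmetric] n) (simp add: w n)
  also have "\<dots> = norm w"
  proof (cases "w = 0")
    case False
    then have "((norm w)\<^sup>2)\<^sup>2 = norm w powr 4" by (simp add: powr_numeral)
    then show ?thesis by (simp only: powr_powr) simp
  qed simp
  finally show ?thesis .
qed

lemma exists_H_minimum:
  fixes u v :: "'n::finite heis \<Rightarrow> real"
  assumes \<Omega>: "open \<Omega>" "horiz_bounded \<Omega>" and u: "H_convex_on \<Omega> u"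
    and \<Omega>0: "open \<Omega>0" "closure \<Omega>0 \<subseteq> \<Omega>"
    and le: "\<forall>\<xi>\<in>\<Omega>0. u \<xi> \<le> v \<xi>" and eq: "\<forall>\<xi>\<in>frontier \<Omega>0. u \<xi> = v \<xi>"
    and \<xi>0: "\<xi>0 \<in> \<Omega>0" and min: "\<And>\<zeta>. \<zeta> \<in> \<Omega> \<inter> Hplane \<xi>0 \<Longrightarrow> \<zeta> \<noteq> \<xi>0 \<Longrightarrow> v \<xi>0 < v \<zeta>"
  shows "\<exists>\<xi>\<in>\<Omega>0. \<forall>\<zeta>\<in>\<Omega> \<inter> Hplane \<xi>. u \<xi> \<le> u \<zeta>"
proof (rule ccontr)
  assume neg: "\<not> ?thesis"
  have sub: "\<Omega>0 \<subseteq> \<Omega>" using \<Omega>0(2) closure_subset by blast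
  define P where "P = hexp \<xi>0"
  have P0: "P 0 = \<xi>0" by (simp add: P_def)
  have cP: "continuous_on UNIV P"
    using continuous_on_hexp[OF continuous_on_const continuous_on_id] by (simp add: P_def)
  have limP: "(P \<longlongrightarrow> P w) (nhds w)" for w
    using continuous_on_interior[OF cP, of w] by (simp add: isCont_def tendsto_nhds_iff)
  define D where "D = P -` \<Omega>0"
  have D: "open D" "0 \<in> D"
    using open_vimage[OF \<Omega>0(1) cP] \<xi>0 P0 by (auto simp: D_def)
  have clD: "P w \<in> closure \<Omega>0" if "w \<in> closure D" for w
    using continuous_image_closure_subset[OF cP, of D] that
      closure_mono[of "P ` D" \<Omega>0] by (auto simp: D_def)
  obtain C where C: "\<And>w. w \<in> D \<Longrightarrow> norm w \<le> C"
  proof -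
    obtain C where C: "\<forall>\<xi>\<in>\<Omega>. \<forall>a\<in>\<Omega> \<inter> Hplane \<xi>. \<forall>b\<in>\<Omega> \<inter> Hplane \<xi>. dH a b \<le> C"
      using \<Omega>(2) by (auto simp: horiz_bounded_def)
    have "dH (P w) \<xi>0 \<le> C" if "w \<in> D" for w
    proof -
      have "P w \<in> \<Omega> \<inter> Hplane \<xi>0" "\<xi>0 \<in> \<Omega> \<inter> Hplane \<xi>0"
        using that \<xi>0 sub hexp_in_Hplane[of \<xi>0 w] Hplane_refl[of \<xi>0] by (auto simp: D_def P_def)
      then show ?thesis using C by blast
    qed
    then show thesis by (intro that) (simp add: P_def dH_hexp)
  qed
  have C0: "C \<ge> 0" using C[OF D(2)] by simp
  \<comment> \<open>The condition for the glued field at \<open>z\<close>. It is closed under sums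
    and positive multiples of \<open>d\<close>, and it excludes 0 because every \<open>z\<close>
    lies in \<open>closure D\<close> or outside \<open>D\<close>.\<close>
  define G where "G = (\<lambda>z d. (z \<in> closure D \<longrightarrow> H_descent \<Omega> u (P z) d) \<and> (z \<notin> D \<longrightarrow> d \<bullet> z < 0))"
  have "\<exists>d. \<forall>\<^sub>F z in nhds w. G z d" for w
  proof (cases "w \<in> D")
    case True
    then have Pw: "P w \<in> \<Omega>0" by (simp add: D_def)
    then obtain \<zeta> where \<zeta>: "\<zeta> \<in> \<Omega>" "\<zeta> \<in> Hplane (P w)" "u \<zeta> < u (P w)" using neg by (auto simp: not_le)
    have "H_descent \<Omega> u (P w) (Pr1 \<zeta> - Pr1 (P w))"
      unfolding H_descent_def using \<zeta> hexp_Pr1_diff[OF \<zeta>(2)] by (intro exI[of _ 1]) simp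
    then have "\<forall>\<^sub>F \<xi> in nhds (P w). H_descent \<Omega> u \<xi> (Pr1 \<zeta> - Pr1 (P w))"
      using Pw sub by (intro H_descent_eventually[OF \<Omega>(1) u]) auto
    then have "\<forall>\<^sub>F z in nhds w. H_descent \<Omega> u (P z) (Pr1 \<zeta> - Pr1 (P w))"
      using eventually_compose_filterlim limP by blast
    moreover have "\<forall>\<^sub>F z in nhds w. z \<in> D" using D(1) True by (rule eventually_nhds_in_open)
    ultimately have "\<forall>\<^sub>F z in nhds w. G z (Pr1 \<zeta> - Pr1 (P w))"
      by eventually_elim (simp add: G_def)
    then show ?thesis by blast
  next
    case False
    then have "w \<noteq> 0" using D(2) by auto
    have "((\<lambda>z. (- w) \<bullet> z) \<longlongrightarrow> (- w) \<bullet> w) (nhds w)"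
      by (intro tendsto_inner tendsto_const filterlim_ident)
    from order_tendstoD(2)[OF this, of 0] have neg_w: "\<forall>\<^sub>F z in nhds w. (- w) \<bullet> z < 0"
      using \<open>w \<noteq> 0\<close> by simp
    have "\<forall>\<^sub>F z in nhds w. z \<in> closure D \<longrightarrow> H_descent \<Omega> u (P z) (- w)"
    proof (cases "w \<in> closure D")
      case True
      then have "P w \<in> closure \<Omega>0" by (rule clD)
      then have Pw: "P w \<in> \<Omega>" "P w \<in> frontier \<Omega>0"
        using \<Omega>0 False by (auto simp: frontier_def interior_open D_def)
      have "P w \<noteq> \<xi>0" using Pw(2) \<xi>0 \<Omega>0(1) by (auto simp: frontier_def interior_open)
      then have "v \<xi>0 < v (P w)" using Pw(1) hexp_in_Hplane[of \<xi>0 w] by (intro min) (auto simp: P_def)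
      then have "u \<xi>0 < u (P w)" using le eq \<xi>0 Pw(2) by force
      \<comment> \<open>The unit step along \<open>- w\<close> leads from \<open>P w\<close> back to
        \<open>\<xi>0\<close>, by \<open>hexp_minus\<close>.\<close>
      then have "H_descent \<Omega> u (P w) (- w)"
        unfolding H_descent_def using \<xi>0 sub by (intro exI[of _ 1]) (auto simp: P_def)
      then have "\<forall>\<^sub>F \<xi> in nhds (P w). H_descent \<Omega> u \<xi> (- w)"
        by (rule H_descent_eventually[OF \<Omega>(1) u Pw(1)])
      then have "\<forall>\<^sub>F z in nhds w. H_descent \<Omega> u (P z) (- w)"
        using eventually_compose_filterlim limP by blast
      then show ?thesis by eventually_elim simp
    next
      case False
      then have "\<forall>\<^sub>F z in nhds w. z \<in> - closure D" by (intro eventually_nhds_in_open) auto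
      then show ?thesis by eventually_elim simp
    qed
    with neg_w have "\<forall>\<^sub>F z in nhds w. G z (- w)" by eventually_elim (simp add: G_def)
    then show ?thesis by blast
  qed
  then have "\<exists>d r. r > 0 \<and> (\<forall>z. dist z w < r \<longrightarrow> G z d)" for w
    unfolding eventually_nhds_metric by blast
  then obtain d r where r: "\<And>w. r w > 0" and dr: "\<And>w z. dist z w < r w \<Longrightarrow> G z (d w)"
    by metis
  have G_scale: "G z (k *\<^sub>R e)" if "G z e" "k > 0" for z e k
    using that by (auto simp: G_def H_descent_scaleR mult_pos_neg)
  have G_add: "G z (e + f)" if "G z e" "G z f" for z e f
  proof -
    have "P z \<in> \<Omega>" if "z \<in> closure D" using clD[OF that] \<Omega>0(2) by blast
    then show ?thesis
      using that H_descent_add[OF \<Omega>(1) u, of "P z" e f] by (auto simp: G_def inner_add_left)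
  qed
  have G_sum: "G z (\<Sum>i\<in>I. f i)" if "finite I" "I \<noteq> {}" "\<And>i. i \<in> I \<Longrightarrow> G z (f i)" for z I f
    using that
  proof (induction I rule: finite_ne_induct)
    case (insert i I)
    have "G z (f i + sum f I)" by (intro G_add insert.IH insert.prems) auto
    then show ?case using insert.hyps by simp
  qed simp
  \<comment> \<open>Larger than the bound \<open>C\<close> on \<open>D\<close>, so the sphere of
    radius \<open>R\<close> misses \<open>D\<close> and the field points inwards there.\<close>
  define R where "R = C + 1"
  have R: "R > 0" using C0 by (simp add: R_def)
  obtain T where T: "finite T" "cball 0 R \<subseteq> (\<Union>w\<in>T. ball w (r w))"
  proof -
    have "z \<in> ball z (r z)" for z using r by simp
    then have "cball 0 R \<subseteq> (\<Union>w\<in>UNIV. ball w (r w))" by blast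
    from compactE_image[OF compact_cball _ this] show thesis using that by auto
  qed
  define W where "W = (\<lambda>z. \<Sum>w\<in>T. max 0 (r w - dist z w) *\<^sub>R d w)"
  have GW: "G z (W z)" if z: "z \<in> cball 0 R" for z
  proof -
    define I where "I = {w \<in> T. dist z w < r w}"
    have "W z = (\<Sum>w\<in>I. max 0 (r w - dist z w) *\<^sub>R d w)"
      unfolding W_def by (rule sum.mono_neutral_right) (auto simp: I_def T)
    moreover have "I \<noteq> {}"
    proof -
      obtain w where "w \<in> T" "z \<in> ball w (r w)" using T(2) z by blast
      then have "w \<in> I" by (simp add: I_def dist_commute)
      then show ?thesis by blast
    qed
    ultimately show ?thesis
      using T(1) by (auto simp: I_def intro!: G_sum G_scale dr)
  qed
  have W0: "W z \<noteq> 0" if "z \<in> cball 0 R" for z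
    using GW[OF that] closure_subset[of D] by (auto simp: G_def)
  \<comment> \<open>A fixed point lies on the sphere and makes \<open>W z\<close> a positive
    multiple of \<open>z\<close>, against \<open>W z \<bullet> z < 0\<close>.\<close>
  obtain z where z: "z \<in> cball 0 R" "(R / norm (W z)) *\<^sub>R W z = z"
  proof (rule brouwer[of "cball 0 R :: ((real^'n) \<times> (real^'n)) set" "\<lambda>z. (R / norm (W z)) *\<^sub>R W z"])
    show "continuous_on (cball 0 R) (\<lambda>z. (R / norm (W z)) *\<^sub>R W z)"
      using W0 unfolding W_def by (intro continuous_intros) auto
    show "(\<lambda>z. (R / norm (W z)) *\<^sub>R W z) \<in> cball 0 R \<rightarrow> cball 0 R" using R W0 by auto
  qed (use R that in auto)
  have "norm ((R / norm (W z)) *\<^sub>R W z) = R" using W0[OF z(1)] R by simp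
  then have "norm z = R" by (simp only: z(2))
  then have "z \<notin> D" using C[of z] by (auto simp: R_def)
  then have "W z \<bullet> z < 0" using GW[OF z(1)] by (simp add: G_def)
  moreover have "W z \<bullet> z = R / norm (W z) * (W z \<bullet> W z)"
    using z(2) by (metis inner_scaleR_right)
  moreover have "R / norm (W z) * (W z \<bullet> W z) \<ge> 0" using R by simp
  ultimately show False by simp
qed

theorem theorem3p4:
  fixes \<Omega> \<Omega>0 :: "'n::finite heis set" and u v :: "'n heis \<Rightarrow> real"
  assumes "open \<Omega>" and "horiz_bounded \<Omega>" and "H_convex_set \<Omega>"
    and "H_convex_fun \<Omega> u" and "strictly_H_convex_fun \<Omega> v"
    and "open \<Omega>0" and "closure \<Omega>0 \<subseteq> \<Omega>"
    and "\<forall>xi\<in>\<Omega>0. u xi \<le> v xi"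
    and "\<forall>xi\<in>frontier \<Omega>0. u xi = v xi"
  shows "H_subdiff_set \<Omega> v \<Omega>0 \<subseteq> H_subdiff_set \<Omega> u \<Omega>0"
proof
  fix p assume "p \<in> H_subdiff_set \<Omega> v \<Omega>0"
  then obtain \<xi>0 where \<xi>0: "\<xi>0 \<in> \<Omega>0"
    and p: "\<And>\<zeta>. \<zeta> \<in> \<Omega> \<Longrightarrow> \<zeta> \<in> Hplane \<xi>0 \<Longrightarrow> v \<xi>0 + p \<bullet> (Pr1 \<zeta> - Pr1 \<xi>0) \<le> v \<zeta>"
    by (auto simp: H_subdiff_set_def H_subdiff_def)
  have \<xi>0\<Omega>: "\<xi>0 \<in> \<Omega>" using \<xi>0 assms(7) closure_subset by blast
  \<comment> \<open>\<open>Pr1\<close> is affine, so H-convexity survives the subtraction; the same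
    term is subtracted from \<open>u\<close> and \<open>v\<close>, so their comparison does
    too.\<close>
  define u' where "u' = (\<lambda>\<xi>. u \<xi> - p \<bullet> Pr1 \<xi>)"
  define v' where "v' = (\<lambda>\<xi>. v \<xi> - p \<bullet> Pr1 \<xi>)"
  have u: "H_convex_on \<Omega> u" by (rule H_convex_onI[OF assms(3,4)])
  have u': "H_convex_on \<Omega> u'"
    unfolding H_convex_on_def
  proof (intro ballI impI conjI)
    fix a b l assume ab: "a \<in> \<Omega>" "b \<in> \<Omega>" "a \<in> Hplane b" and "l \<in> {0..1::real}"
    then have l: "0 \<le> l" "l \<le> 1" by auto
    note D = H_convex_onD[OF u ab l]
    show "(1 - l) *\<^sub>R a + l *\<^sub>R b \<in> \<Omega>" by (rule D(2))
    show "u' ((1 - l) *\<^sub>R a + l *\<^sub>R b) \<le> (1 - l) * u' a + l * u' b"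
      using D(1) unfolding u'_def Pr1_affine inner_add_right inner_scaleR_right right_diff_distrib
      by linarith
  qed
  have v: "H_convex_on \<Omega> v"
    using assms(5) by (intro H_convex_onI[OF assms(3)]) (simp add: strictly_H_convex_fun_def)
  \<comment> \<open>The midpoint \<open>?m\<close> stays in the plane through \<open>\<xi>0\<close>,
    so \<open>v' \<xi>0 \<le> v' ?m\<close>, while strict convexity puts \<open>v' ?m\<close> below
    the mean of \<open>v' \<zeta>\<close> and \<open>v' \<xi>0\<close>.\<close>
  have strict: "v' \<xi>0 < v' \<zeta>" if \<zeta>: "\<zeta> \<in> \<Omega> \<inter> Hplane \<xi>0" "\<zeta> \<noteq> \<xi>0" for \<zeta>
  proof -
    let ?m = "(1 - 1/2) *\<^sub>R \<zeta> + (1/2) *\<^sub>R \<xi>0"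
    have "?m \<in> \<Omega>" using H_convex_onD(2)[OF v, of \<zeta> \<xi>0 "1/2"] \<zeta> \<xi>0\<Omega> by simp
    moreover have "?m \<in> Hplane \<xi>0"
      using Hplane_line[of \<zeta> \<xi>0 "1/2"] \<zeta> by (simp add: add.commute)
    ultimately have "v \<xi>0 + p \<bullet> (Pr1 ?m - Pr1 \<xi>0) \<le> v ?m" by (rule p)
    then have "v' \<xi>0 \<le> v ?m - p \<bullet> Pr1 ?m" by (simp add: v'_def inner_diff_right)
    moreover have "v ?m < (1 - 1/2) * v \<zeta> + 1/2 * v \<xi>0"
    proof -
      have "v (hmult \<zeta> (hdil (1/2) (hmult (hinv \<zeta>) \<xi>0))) < (1 - 1/2) * v \<zeta> + 1/2 * v \<xi>0"
      proof -
        have "\<forall>l\<in>{0<..<1}. v (hmult \<zeta> (hdil l (hmult (hinv \<zeta>) \<xi>0))) < (1 - l) * v \<zeta> + l * v \<xi>0"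
          using assms(5) \<zeta> \<xi>0\<Omega> unfolding strictly_H_convex_fun_def by blast
        from bspec[OF this, of "1/2"] show ?thesis by simp
      qed
      then show ?thesis using H_segment[of \<zeta> \<xi>0 "1/2"] \<zeta> by simp
    qed
    ultimately show ?thesis
      unfolding Pr1_affine by (simp add: v'_def inner_add_right)
  qed
  have "\<exists>\<xi>\<in>\<Omega>0. \<forall>\<zeta>\<in>\<Omega> \<inter> Hplane \<xi>. u' \<xi> \<le> u' \<zeta>"
    by (rule exists_H_minimum[where v = v', OF assms(1,2) u' assms(6,7) _ _ \<xi>0 strict])
      (use assms(8,9) in \<open>auto simp: u'_def v'_def\<close>)
  then obtain \<xi> where \<xi>: "\<xi> \<in> \<Omega>0" "\<And>\<zeta>. \<zeta> \<in> \<Omega> \<inter> Hplane \<xi> \<Longrightarrow> u' \<xi> \<le> u' \<zeta>" by blast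
  have "p \<in> H_subdiff \<Omega> u \<xi>"
    using \<xi>(2) by (force simp: H_subdiff_def u'_def inner_diff_right)
  then show "p \<in> H_subdiff_set \<Omega> u \<Omega>0" using \<xi>(1) by (auto simp: H_subdiff_set_def)
qed

end
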